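(* Let $\alpha>0$, let $\nu\in\mathcal{P}_+$, and let $R(t)=\mathbf{E}N(t)$ be the renewal function of the renewal process for the Kendall convolution $\vartriangle_\alpha$ with unit step distribution $\nu$. Suppose that $H\in RV_\theta$, where $0\le\theta<\alpha$. Then $$x^{-\alpha}R(x)H(x)\to\alpha^{-2}(\alpha-\theta)(2\alpha-\theta)\qquad\text{as }x\to\infty.$$
   Context: $\mathcal{P}_+$ is the set of Borel probability measures on $[0,\infty)$. For $\alpha>0$ the Kendall convolution $\vartriangle_\alpha$ is the commutative, associative operation on $\mathcal{P}_+$ given by $\delta_x\vartriangle_\alpha\delta_1=(1-x^\alpha)\delta_1+x^\alpha\pi_{2\alpha}$ for $x\in[0,1]$, where $\pi_{2\alpha}(dy)=2\alpha y^{-2\alpha-1}\mathbf{1}_{[1,\infty)}(y)\,dy$; by scaling, for $0\le x\le y$, $y>0$, $\delta_x\vartriangle_\alpha\delta_y$ is the law of $yX$ where $X$ has law $\delta_{x/y}\vartriangle_\alpha\delta_1$; $\delta_0\vartriangle_\alpha\delta_0=\delta_0$; and $(\lambda_1\vartriangle_\alpha\lambda_2)(A)=\int\int(\delta_x\vartriangle_\alpha\delta_y)(A)\,\lambda_1(dx)\lambda_2(dy)$. $\nu^{\vartriangle_\alpha n}$ is the $n$-fold convolution power. The Kendall random walk with step distribution $\nu$ is the Markov process $(S_n)_{n\ge1}$ with $\mathcal{L}(S_1)=\nu$ and $P(S_n\in\cdot\mid S_k=x)=\delta_x\vartriangle_\alpha\nu^{\vartriangle_\alpha(n-k)}$ for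 $k<n$. The renewal process is $N(t)=\inf\{n\ge0:S_{n+1}>t\}$ ($=\infty$ if no such $n$ exists). $H(t)=\int_{[0,t]}x^\alpha\,\nu(dx)$. A measurable function $f$, positive for all sufficiently large arguments, is regularly varying at infinity with index $\beta$ ($f\in RV_\beta$) if $\lim_{t\to\infty}f(tx)/f(t)=x^\beta$ for all $x>0$. *)

theory Defs
  imports "HOL-Probability.Probability"
begin

section \<open>The Kendall convolution\<close>

definition nonneg_prob :: "real measure set" where
  "nonneg_prob = {\<nu>. prob_space \<nu> \<and> sets \<nu> = sets borel \<and> (AE x in \<nu>. 0 \<le> x)}"

definition pareto :: "real \<Rightarrow> real measure" where
  "pareto \<beta> = density lborel (\<lambda>y. ennreal (\<beta> * y powr (- \<beta> - 1)) * indicator {1..} y)"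

text \<open>The law $\delta_x \vartriangle_\alpha \delta_1$; meaningful for $0 \le x \le 1$.\<close>

definition kendall_unit :: "real \<Rightarrow> real \<Rightarrow> real measure" where
  "kendall_unit \<alpha> x = measure_of UNIV (sets borel)
     (\<lambda>A. ennreal (1 - x powr \<alpha>) * emeasure (return borel 1) A
        + ennreal (x powr \<alpha>) * emeasure (pareto (2 * \<alpha>)) A)"

text \<open>The law $\delta_x \vartriangle_\alpha \delta_y$ for $x, y \ge 0$. If an argument is negative
  the value $\delta_0$ is a dummy, which makes the kernel total and measurable on all of
  $\real \times \real$; it is never seen by measures concentrated on $[0,\infty)$.\<close>

definition kendall_kernel :: "real \<Rightarrow> real \<Rightarrow> real \<Rightarrow> real measure" where
  "kendall_kernel \<alpha> x y =
     (if 0 \<le> x \<and> 0 \<le> y \<and> 0 < max x y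
      then distr (kendall_unit \<alpha> (min x y / max x y)) borel (\<lambda>u. max x y * u)
      else return borel 0)"

definition kendall_conv :: "real \<Rightarrow> real measure \<Rightarrow> real measure \<Rightarrow> real measure" where
  "kendall_conv \<alpha> \<mu>1 \<mu>2 = \<mu>1 \<bind> (\<lambda>x. \<mu>2 \<bind> (\<lambda>y. kendall_kernel \<alpha> x y))"

text \<open>The convolution power; $\delta_0$ is the neutral element of the convolution.\<close>

primrec kendall_power :: "real \<Rightarrow> real measure \<Rightarrow> nat \<Rightarrow> real measure" where
  "kendall_power \<alpha> \<nu> 0 = return borel 0"
| "kendall_power \<alpha> \<nu> (Suc n) = kendall_conv \<alpha> \<nu> (kendall_power \<alpha> \<nu> n)"


section \<open>Random walk and renewal function\<close>

definition past_sigma :: "'w measure \<Rightarrow> (nat \<Rightarrow> 'w \<Rightarrow> real) \<Rightarrow> nat \<Rightarrow> 'w measure" where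
  "past_sigma M S k =
     sigma (space M) {S i -` B \<inter> space M | i B. 1 \<le> i \<and> i \<le> k \<and> B \<in> sets borel}"

text \<open>The walk is indexed by $n \ge 1$; the component \<open>S 0\<close> is irrelevant. The last clause
  is the Markov property together with the transition probabilities: given
  $S_1, \dots, S_k$, the conditional law of $S_n$ is $\delta_{S_k} \vartriangle_\alpha
  \nu^{\vartriangle_\alpha (n-k)}$.\<close>

definition kendall_random_walk ::
  "real \<Rightarrow> real measure \<Rightarrow> 'w measure \<Rightarrow> (nat \<Rightarrow> 'w \<Rightarrow> real) \<Rightarrow> bool" where
  "kendall_random_walk \<alpha> \<nu> M S \<longleftrightarrow>
     prob_space M \<and>
     (\<forall>n\<ge>1. S n \<in> borel_measurable M \<and> (\<forall>\<omega>\<in>space M. 0 \<le> S n \<omega>)) \<and>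
     distr M borel (S 1) = \<nu> \<and>
     (\<forall>k n. 1 \<le> k \<longrightarrow> k < n \<longrightarrow> (\<forall>A\<in>sets borel. AE \<omega> in M.
        real_cond_exp M (past_sigma M S k) (\<lambda>\<omega>. indicator A (S n \<omega>)) \<omega>
        = measure (kendall_conv \<alpha> (return borel (S k \<omega>)) (kendall_power \<alpha> \<nu> (n - k))) A))"

text \<open>The infimum is taken in \<^typ>\<open>enat\<close>, so that it is \<open>\<infinity>\<close> for the empty set.\<close>

definition renewal_process :: "(nat \<Rightarrow> 'w \<Rightarrow> real) \<Rightarrow> real \<Rightarrow> 'w \<Rightarrow> enat" where
  "renewal_process S t \<omega> = Inf {enat n | n. S (Suc n) \<omega> > t}"

definition renewal_function :: "'w measure \<Rightarrow> (nat \<Rightarrow> 'w \<Rightarrow> real) \<Rightarrow> real \<Rightarrow> ennreal" where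
  "renewal_function M S t = (\<integral>\<^sup>+\<omega>. ennreal_of_enat (renewal_process S t \<omega>) \<partial>M)"

definition truncated_moment :: "real \<Rightarrow> real measure \<Rightarrow> real \<Rightarrow> real" where
  "truncated_moment \<alpha> \<nu> t = (LINT x:{0..t}|\<nu>. x powr \<alpha>)"

definition regularly_varying :: "real \<Rightarrow> (real \<Rightarrow> real) \<Rightarrow> bool" where
  "regularly_varying \<beta> f \<longleftrightarrow>
     f \<in> borel_measurable borel \<and>
     (\<forall>\<^sub>F t in at_top. 0 < f t) \<and>
     (\<forall>x>0. ((\<lambda>t. f (t * x) / f t) \<longlongrightarrow> x powr \<beta>) at_top)"


section \<open>The convolution has the intended values\<close>

lemma sets_pareto [simp, measurable_cong]: "sets (pareto \<beta>) = sets borel"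
  by (simp add: pareto_def)

lemma space_pareto [simp]: "space (pareto \<beta>) = UNIV"
  by (simp add: pareto_def)

lemma prob_space_pareto:
  assumes "\<beta> > 0"
  shows "prob_space (pareto \<beta>)"
proof
  have lim: "((\<lambda>y. - (y powr (- \<beta>))) \<longlongrightarrow> - 0) at_top"
    using assms by (intro tendsto_minus tendsto_neg_powr filterlim_ident) auto
  have "(\<integral>\<^sup>+y. ennreal (\<beta> * y powr (- \<beta> - 1)) * indicator {1..} y \<partial>lborel)
      = ennreal (- 0 - (- (1 powr (- \<beta>))))"
  proof (rule nn_integral_FTC_atLeast[OF _ _ _ lim])
    fix x :: real assume "1 \<le> x"
    then show "((\<lambda>y. - (y powr (- \<beta>))) has_real_derivative \<beta> * x powr (- \<beta> - 1)) (at x)"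
      by (auto intro!: derivative_eq_intros)
  qed (use assms in auto)
  then show "emeasure (pareto \<beta>) (space (pareto \<beta>)) = 1"
    by (simp add: pareto_def emeasure_density)
qed

lemma sets_kendall_unit [simp, measurable_cong]: "sets (kendall_unit \<alpha> x) = sets borel"
  using sets.sigma_sets_eq[of "borel :: real measure"] by (simp add: kendall_unit_def)

lemma space_kendall_unit [simp]: "space (kendall_unit \<alpha> x) = UNIV"
  by (simp add: kendall_unit_def)

lemma emeasure_kendall_unit:
  assumes "A \<in> sets borel"
  shows "emeasure (kendall_unit \<alpha> x) A =
    ennreal (1 - x powr \<alpha>) * indicator A 1 + ennreal (x powr \<alpha>) * emeasure (pareto (2 * \<alpha>)) A"
proof -
  let ?f = "\<lambda>A. ennreal (1 - x powr \<alpha>) * emeasure (return borel 1) A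
        + ennreal (x powr \<alpha>) * emeasure (pareto (2 * \<alpha>)) A"
  have "emeasure (kendall_unit \<alpha> x) A = ?f A"
  proof (rule emeasure_measure_of[OF kendall_unit_def])
    show "countably_additive (sets (kendall_unit \<alpha> x)) ?f"
    proof (rule countably_additiveI)
      fix B :: "nat \<Rightarrow> real set"
      assume *: "range B \<subseteq> sets (kendall_unit \<alpha> x)" "disjoint_family B"
      then have "(\<Sum>i. emeasure (return borel 1) (B i)) = emeasure (return borel 1) (\<Union>i. B i)"
        "(\<Sum>i. emeasure (pareto (2 * \<alpha>)) (B i)) = emeasure (pareto (2 * \<alpha>)) (\<Union>i. B i)"
        by (simp_all add: suminf_emeasure del: emeasure_return)
      then show "(\<Sum>i. ?f (B i)) = ?f (\<Union>i. B i)"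
        by (simp add: suminf_add[symmetric] ennreal_suminf_cmult)
    qed
  qed (use assms in \<open>auto simp: positive_def\<close>)
  then show ?thesis using assms by simp
qed

lemma prob_space_kendall_unit:
  assumes "\<alpha> > 0" "0 \<le> x" "x \<le> 1"
  shows "prob_space (kendall_unit \<alpha> x)"
proof
  interpret prob_space "pareto (2 * \<alpha>)" using assms by (intro prob_space_pareto) auto
  have "x powr \<alpha> \<le> 1" using assms by (simp add: powr_le1)
  then show "emeasure (kendall_unit \<alpha> x) (space (kendall_unit \<alpha> x)) = 1"
    using emeasure_space_1
    by (simp add: emeasure_kendall_unit ennreal_plus[symmetric] del: ennreal_plus)
qed

lemma sets_kendall_kernel [simp, measurable_cong]: "sets (kendall_kernel \<alpha> x y) = sets borel"
  by (simp add: kendall_kernel_def)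

lemma prob_space_kendall_kernel:
  assumes "\<alpha> > 0"
  shows "prob_space (kendall_kernel \<alpha> x y)"
proof (cases "0 \<le> x \<and> 0 \<le> y \<and> 0 < max x y")
  case True
  then have "prob_space (kendall_unit \<alpha> (min x y / max x y))"
    using assms by (intro prob_space_kendall_unit) (auto simp: divide_simps)
  then show ?thesis using True
    by (auto simp: kendall_kernel_def intro!: prob_space.prob_space_distr)
next
  case False
  then show ?thesis by (auto simp: kendall_kernel_def intro!: prob_space_return)
qed

lemma emeasure_kendall_kernel:
  assumes [measurable]: "A \<in> sets borel"
  shows "emeasure (kendall_kernel \<alpha> x y) A =
    (if 0 \<le> x \<and> 0 \<le> y \<and> 0 < max x y
     then ennreal (1 - (min x y / max x y) powr \<alpha>) * indicator A (max x y)
        + ennreal ((min x y / max x y) powr \<alpha>)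
          * (\<integral>\<^sup>+u. indicator A (max x y * u) \<partial>pareto (2 * \<alpha>))
     else indicator A 0)"
proof -
  have "emeasure (kendall_unit \<alpha> z) ((\<lambda>u. m * u) -` A) =
      ennreal (1 - z powr \<alpha>) * indicator A m
      + ennreal (z powr \<alpha>) * (\<integral>\<^sup>+u. indicator A (m * u) \<partial>pareto (2 * \<alpha>))" for z m
  proof -
    have B: "(\<lambda>u. m * u) -` A \<in> sets borel"
      using measurable_sets_borel[of "\<lambda>u. m * u" borel A] by simp
    have "(\<integral>\<^sup>+u. indicator A (m * u) \<partial>pareto (2 * \<alpha>))
        = (\<integral>\<^sup>+u. indicator ((\<lambda>u. m * u) -` A) u \<partial>pareto (2 * \<alpha>))"
      by (intro nn_integral_cong) (auto simp: indicator_def)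
    also have "\<dots> = emeasure (pareto (2 * \<alpha>)) ((\<lambda>u. m * u) -` A)"
      using B by simp
    finally show ?thesis using B by (simp add: emeasure_kendall_unit indicator_def)
  qed
  then show ?thesis by (auto simp: kendall_kernel_def emeasure_distr)
qed

lemma measurable_kendall_kernel:
  assumes "\<alpha> > 0"
  shows "(\<lambda>(x, y). kendall_kernel \<alpha> x y) \<in> borel \<Otimes>\<^sub>M borel \<rightarrow>\<^sub>M prob_algebra borel"
proof (intro measurable_prob_algebraI measurable_subprob_algebra)
  interpret P: prob_space "pareto (2 * \<alpha>)" using assms by (intro prob_space_pareto) auto
  fix A :: "real set" assume [measurable]: "A \<in> sets borel"
  show "(\<lambda>p. emeasure (case p of (x, y) \<Rightarrow> kendall_kernel \<alpha> x y) A)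
      \<in> borel_measurable (borel \<Otimes>\<^sub>M borel)"
    by (simp add: split_beta' emeasure_kendall_kernel)
qed (auto simp: split_beta' assms prob_space_kendall_kernel intro!: prob_space_imp_subprob_space)

lemma nonneg_prob_in_prob_algebra:
  "\<mu>1 \<in> nonneg_prob \<Longrightarrow> \<mu>1 \<in> space (prob_algebra borel)"
  by (simp add: nonneg_prob_def space_prob_algebra)

theorem emeasure_kendall_conv:
  assumes "\<alpha> > 0" "\<mu>1 \<in> nonneg_prob" "\<mu>2 \<in> nonneg_prob" "A \<in> sets borel"
  shows "emeasure (kendall_conv \<alpha> \<mu>1 \<mu>2) A =
    (\<integral>\<^sup>+x. \<integral>\<^sup>+y. emeasure (kendall_kernel \<alpha> x y) A \<partial>\<mu>2 \<partial>\<mu>1)"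
proof -
  note [measurable] = measurable_kendall_kernel[OF assms(1)]
  note L = assms(2,3)[THEN nonneg_prob_in_prob_algebra]
  have k: "(\<lambda>y. kendall_kernel \<alpha> x y) \<in> borel \<rightarrow>\<^sub>M prob_algebra borel" for x
    using measurable_compose[OF measurable_Pair1' measurable_kendall_kernel[OF assms(1)], of x]
    by simp
  have "(\<lambda>x. \<mu>2 \<bind> (\<lambda>y. kendall_kernel \<alpha> x y)) \<in> borel \<rightarrow>\<^sub>M prob_algebra borel"
    using L(2) by (intro measurable_bind_prob_space2[where N = borel]) simp_all
  then have "emeasure (kendall_conv \<alpha> \<mu>1 \<mu>2) A
      = (\<integral>\<^sup>+x. emeasure (\<mu>2 \<bind> (\<lambda>y. kendall_kernel \<alpha> x y)) A \<partial>\<mu>1)"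
    unfolding kendall_conv_def by (rule emeasure_bind_prob_algebra[OF L(1) _ assms(4)])
  also have "\<dots> = (\<integral>\<^sup>+x. \<integral>\<^sup>+y. emeasure (kendall_kernel \<alpha> x y) A \<partial>\<mu>2 \<partial>\<mu>1)"
    by (simp add: emeasure_bind_prob_algebra[OF L(2) k assms(4)])
  finally show ?thesis .
qed

end

(*
  The Williamson transform G(t) of nu, i.e. the integral of (1 - (x/t)^alpha)_+, is multiplicative
  under the Kendall convolution.  Put h(t) = t^(-alpha) H(t).  One step of the walk from x ends in
  [0,t] with probability G 1{x <= t} + h (1 - (x/t)^alpha)_+, so the two quantities
  P(S_1,...,S_n <= t) and E[(1 - (S_n/t)^alpha)_+; S_1,...,S_n <= t] satisfy a linear recursion,
  solved by G^n + n h G^(n-1) and G^n.  Summing over n gives R = G/(1-G) + h/(1-G)^2.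
  Finally (1 - r^(-alpha)) h(t) <= G(rt) - G(t) <= (r^alpha - 1) h(rt) for r > 1, and since
  h(rt)/h(t) -> r^(theta - alpha) < 1, summing these increments along t, rt, r^2 t, ... and letting
  r decrease to 1 yields (1 - G)/h -> alpha/(alpha - theta), without Karamata's theorem.
*)

theory Submission
  imports Defs "HOL-Real_Asymp.Real_Asymp"
begin

text \<open>Fix the level t and kill the walk when it leaves [0,t]. With a = (x/t)^\<alpha> and b =
  (y/t)^\<alpha> for x, y \<le> t, the kernel gives the value (1-a)(1-b) for the integral of (1 -
  (u/t)^\<alpha>)_+ and the mass 1 - ab to [0,t]. Since 1 - ab = (1-b) + (1-a) b, the killed
  one-step operator preserves the span of the functions 1 and 1 - (x/t)^\<alpha> on [0,t]. It acts
  there as a Jordan block with eigenvalue G and off-diagonal entry h, which is the source of the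
  term n h G^(n-1) and of the double pole of R at G = 1.

  Since x^(-\<alpha>) H(x) is h itself, the quantity in question is h R = G c + c^2 with c =
  h/(1-G). As G tends to 1 and c to 1 - \<theta>/\<alpha>, the limit is (1 - \<theta>/\<alpha>)(2 -
  \<theta>/\<alpha>), the stated constant.

  The Markov property is given as an almost sure identity for each Borel set separately; it is
  turned into an identity of integrals over events of the past before it is iterated.\<close>

section \<open>Tail sums of a regularly varying function\<close>

text \<open>Dividing numerator and denominator by x - 1 produces the difference quotients of x^a and
  x^b at 1, whose limits are a and b. With a = -\<alpha> and b = \<theta> - \<alpha> this is where
  the limit \<alpha> / (\<alpha> - \<theta>) comes from.\<close>

lemma tendsto_powr_difference_quotient:
  fixes a b :: real
  assumes "b \<noteq> 0"
  shows "((\<lambda>x. (1 - x powr a) / (1 - x powr b)) \<longlongrightarrow> a / b) (at_right 1)"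
proof -
  have D: "((\<lambda>x. (x powr c - 1) / (x - 1)) \<longlongrightarrow> c) (at_right 1)" for c :: real
  proof -
    have "((\<lambda>x. x powr c) has_real_derivative c) (at 1)"
      by (auto intro!: derivative_eq_intros)
    then have "((\<lambda>x. (x powr c - 1) / (x - 1)) \<longlongrightarrow> c) (at 1)"
      by (simp add: has_field_derivative_iff)
    then show ?thesis by (rule filterlim_mono) (auto simp: at_le)
  qed
  have "((\<lambda>x. ((x powr a - 1) / (x - 1)) / ((x powr b - 1) / (x - 1))) \<longlongrightarrow> a / b) (at_right 1)"
    by (intro tendsto_divide D assms)
  moreover have "\<forall>\<^sub>F x in at_right 1. ((x powr a - 1) / (x - 1)) / ((x powr b - 1) / (x - 1))
      = (1 - x powr a) / (1 - x powr b)"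
    using eventually_at_right_less
  proof eventually_elim
    case (elim x)
    have "((x powr a - 1) / (x - 1)) / ((x powr b - 1) / (x - 1)) = (x powr a - 1) / (x powr b - 1)"
      using elim by simp
    also have "\<dots> = (1 - x powr a) / (1 - x powr b)"
      by (subst minus_divide_divide[symmetric]) (simp only: minus_diff_eq)
    finally show ?case .
  qed
  ultimately show ?thesis by (rule Lim_transform_eventually)
qed

text \<open>The increments of \<open>U\<close> along t, r t, r^2 t, ... dominate d q^k h(t); they
  telescope to \<open>U t\<close> because \<open>U\<close> vanishes at infinity, and the geometric
  series gives the factor 1/(1-q). The signs of \<open>U\<close> and \<open>h\<close> are left free
  so that the same bound, applied to -U and -h, yields the upper estimate.\<close>

lemma ratio_lower_bound:
  fixes U h :: "real \<Rightarrow> real"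
  assumes "1 < r" "0 < q" "q < 1" "0 \<le> d" "0 < T" "T \<le> t"
    and step: "\<And>s. T \<le> s \<Longrightarrow> d * h s \<le> U s - U (r * s)"
    and ratio: "\<And>s. T \<le> s \<Longrightarrow> q * h s \<le> h (r * s)"
    and lim: "(U \<longlongrightarrow> 0) at_top"
  shows "d / (1 - q) * h t \<le> U t"
proof -
  have T: "T \<le> r ^ k * t" for k
    using mult_mono[of 1 "r ^ k" T t] assms by simp
  have hk: "q ^ k * h t \<le> h (r ^ k * t)" for k
  proof (induction k)
    case (Suc k)
    then have "q * (q ^ k * h t) \<le> q * h (r ^ k * t)" using assms by simp
    also have "\<dots> \<le> h (r * (r ^ k * t))" by (rule ratio[OF T])
    finally show ?case by (simp add: mult_ac)
  qed simp
  have sum: "d * (\<Sum>k<n. q ^ k) * h t \<le> U t - U (r ^ n * t)" for n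
  proof (induction n)
    case (Suc n)
    have "d * (q ^ n * h t) \<le> d * h (r ^ n * t)" using hk assms by (intro mult_left_mono)
    also have "\<dots> \<le> U (r ^ n * t) - U (r ^ Suc n * t)"
      using step[OF T[of n]] by (simp add: mult_ac)
    finally show ?case using Suc by (simp add: algebra_simps)
  qed simp
  have "(\<lambda>n. \<Sum>k<n. q ^ k) \<longlonglongrightarrow> 1 / (1 - q)"
    using geometric_sums[of q] assms by (simp add: sums_def)
  then have L: "(\<lambda>n. d * (\<Sum>k<n. q ^ k) * h t) \<longlonglongrightarrow> d * (1 / (1 - q)) * h t"
    by (intro tendsto_intros)
  have "filterlim (\<lambda>n. r ^ n * t) at_top sequentially"
    using assms by real_asymp
  then have "(\<lambda>n. U t - U (r ^ n * t)) \<longlonglongrightarrow> U t - 0"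
    by (intro tendsto_intros filterlim_compose[OF lim])
  from LIMSEQ_le[OF L this] sum show ?thesis by auto
qed

text \<open>For c on either side of the limit the parameters are chosen in the order r, q, T. The
  ratio r is taken so close to 1 that the geometric constant at q = r^(\<theta>-\<alpha>) lies
  strictly between c and infinity or between 0 and c; then q is moved slightly off that value, which
  leaves room for h(r t)/h(t) to be merely convergent; finally T marks where the resulting
  inequality holds.\<close>

lemma karamata_ratio_limit:
  fixes U h :: "real \<Rightarrow> real"
  assumes "0 \<le> \<theta>" "\<theta> < \<alpha>"
    and h_pos: "\<forall>\<^sub>F t in at_top. 0 < h t"
    and h_lim: "\<And>r. 1 < r \<Longrightarrow> ((\<lambda>t. h (r * t) / h t) \<longlongrightarrow> r powr (\<theta> - \<alpha>)) at_top"
    and lower: "\<And>t r. 0 < t \<Longrightarrow> 1 < r \<Longrightarrow> (1 - r powr (- \<alpha>)) * h t \<le> U t - U (r * t)"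
    and upper: "\<And>t r. 0 < t \<Longrightarrow> 1 < r \<Longrightarrow> U t - U (r * t) \<le> (r powr \<alpha> - 1) * h (r * t)"
    and lim: "(U \<longlongrightarrow> 0) at_top"
  shows "((\<lambda>t. U t / h t) \<longlongrightarrow> \<alpha> / (\<alpha> - \<theta>)) at_top"
proof (rule order_tendstoI)
  define \<beta> where "\<beta> = \<theta> - \<alpha>"
  have \<beta>: "\<beta> < 0" using assms by (simp add: \<beta>_def)
  have lt1: "r powr \<beta> < 1" if "1 < r" for r :: real
    using powr_less_mono[of \<beta> 0 r] that \<beta> by simp
  have L: "((\<lambda>x. (1 - x powr (-\<alpha>)) / (1 - x powr \<beta>)) \<longlongrightarrow> \<alpha> / (\<alpha> - \<theta>)) (at_right 1)"
    using tendsto_powr_difference_quotient[of \<beta> "-\<alpha>"] \<beta>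
      minus_divide_divide[of \<alpha> "\<alpha> - \<theta>"]
    by (simp only: \<beta>_def minus_diff_eq)
  {
    fix c assume "c < \<alpha> / (\<alpha> - \<theta>)"
    from eventually_happens'[OF trivial_limit_at_right_real
        eventually_conj[OF eventually_at_right_less order_tendstoD(1)[OF L this]]]
    obtain r where r: "1 < r" "c < (1 - r powr (-\<alpha>)) / (1 - r powr \<beta>)" by blast
    \<comment> \<open>Here q approaches r^\<beta> from below, so that q h(t) \<le> h(r t) holds for
      all large t.\<close>
    have "((\<lambda>q. (1 - r powr (-\<alpha>)) / (1 - q)) \<longlongrightarrow> (1 - r powr (-\<alpha>)) / (1 - r powr \<beta>)) (at_left (r powr \<beta>))"
      using lt1[OF r(1)] by (intro tendsto_intros) auto
    from order_tendstoD(1)[OF this r(2)]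
    have "\<forall>\<^sub>F q in at_left (r powr \<beta>). c < (1 - r powr (-\<alpha>)) / (1 - q) \<and> q \<in> {0<..<r powr \<beta>}"
      using r by (intro eventually_conj eventually_at_left_real) auto
    then obtain q where q: "c < (1 - r powr (-\<alpha>)) / (1 - q)" "0 < q" "q < r powr \<beta>"
      using eventually_happens'[OF trivial_limit_at_left_real] by (blast dest: greaterThanLessThan_iff[THEN iffD1])
    have "\<forall>\<^sub>F t in at_top. q < h (r * t) / h t"
      using order_tendstoD(1)[OF h_lim[OF r(1)]] q by (simp add: \<beta>_def)
    with h_pos eventually_gt_at_top[of 0] have "\<forall>\<^sub>F t in at_top. 0 < t \<and> 0 < h t \<and> q * h t \<le> h (r * t)"
      by eventually_elim (simp add: field_simps)
    then obtain T where T: "\<And>t. T \<le> t \<Longrightarrow> 0 < t \<and> 0 < h t \<and> q * h t \<le> h (r * t)"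
      unfolding eventually_at_top_linorder by blast
    show "\<forall>\<^sub>F t in at_top. c < U t / h t"
      unfolding eventually_at_top_linorder
    proof (intro exI[of _ T] allI impI)
      fix t assume t: "T \<le> t"
      have "(1 - r powr (-\<alpha>)) / (1 - q) * h t \<le> U t"
        using T t r lt1[OF r(1)] q lower lim powr_less_mono[of "-\<alpha>" 0 r] assms(1,2)
        by (intro ratio_lower_bound[where T = T]) (auto intro: less_imp_le)
      then have "(1 - r powr (-\<alpha>)) / (1 - q) \<le> U t / h t" using T[OF t] by (simp add: pos_le_divide_eq)
      then show "c < U t / h t" using q by linarith
    qed
  next
    fix c assume c: "\<alpha> / (\<alpha> - \<theta>) < c"
    \<comment> \<open>The constant of the upper estimate is (r^\<alpha> - 1) r^\<beta> / (1 -
      r^\<beta>). It equals r^\<theta> times the constant of the lower estimate, so both have the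
      same limit as r decreases to 1.\<close>
    have "((\<lambda>x. x powr \<theta> * ((1 - x powr (-\<alpha>)) / (1 - x powr \<beta>))) \<longlongrightarrow> 1 powr \<theta> * (\<alpha> / (\<alpha> - \<theta>))) (at_right 1)"
      by (intro tendsto_intros L) auto
    from order_tendstoD(2)[OF this, of c] c
    have "\<forall>\<^sub>F x in at_right 1. x powr \<theta> * ((1 - x powr (-\<alpha>)) / (1 - x powr \<beta>)) < c" by simp
    from eventually_happens'[OF trivial_limit_at_right_real eventually_conj[OF eventually_at_right_less this]]
    obtain r where r: "1 < r" "r powr \<theta> * ((1 - r powr (-\<alpha>)) / (1 - r powr \<beta>)) < c" by blast
    have "r powr \<theta> * (1 - r powr (-\<alpha>)) = (r powr \<alpha> - 1) * r powr \<beta>"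
      using r by (simp add: algebra_simps \<beta>_def flip: powr_add)
    with r have r2: "(r powr \<alpha> - 1) * r powr \<beta> / (1 - r powr \<beta>) < c" by simp
    have "((\<lambda>q. (r powr \<alpha> - 1) * q / (1 - q)) \<longlongrightarrow> (r powr \<alpha> - 1) * r powr \<beta> / (1 - r powr \<beta>)) (at_right (r powr \<beta>))"
      using lt1[OF r(1)] by (intro tendsto_intros) auto
    from order_tendstoD(2)[OF this r2]
    have "\<forall>\<^sub>F q in at_right (r powr \<beta>). (r powr \<alpha> - 1) * q / (1 - q) < c \<and> q \<in> {r powr \<beta><..<1}"
      using lt1[OF r(1)] by (intro eventually_conj eventually_at_right_real) auto
    then obtain q where q: "(r powr \<alpha> - 1) * q / (1 - q) < c" "r powr \<beta> < q" "q < 1"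
      using eventually_happens'[OF trivial_limit_at_right_real] by (blast dest: greaterThanLessThan_iff[THEN iffD1])
    have q0: "0 < q" using q(2) r(1) by (meson le_less_trans powr_ge_zero)
    have d: "0 \<le> r powr \<alpha> - 1" using r assms(1,2) by (simp add: ge_one_powr_ge_zero)
    have "\<forall>\<^sub>F t in at_top. h (r * t) / h t < q"
      using order_tendstoD(2)[OF h_lim[OF r(1)]] q by (simp add: \<beta>_def)
    with h_pos eventually_gt_at_top[of 0] have "\<forall>\<^sub>F t in at_top. 0 < t \<and> 0 < h t \<and> h (r * t) \<le> q * h t"
      by eventually_elim (simp add: field_simps)
    then obtain T where T: "\<And>t. T \<le> t \<Longrightarrow> 0 < t \<and> 0 < h t \<and> h (r * t) \<le> q * h t"
      unfolding eventually_at_top_linorder by blast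
    show "\<forall>\<^sub>F t in at_top. U t / h t < c"
      unfolding eventually_at_top_linorder
    proof (intro exI[of _ T] allI impI)
      fix t assume t: "T \<le> t"
      \<comment> \<open>The extra factor q in the constant appears because the upper increment is
        measured by h(r s), which is at most q h(s).\<close>
      have "(r powr \<alpha> - 1) * q / (1 - q) * - h t \<le> - U t"
      proof (rule ratio_lower_bound[where T = T and U = "\<lambda>t. - U t" and h = "\<lambda>t. - h t"])
        fix s assume s: "T \<le> s"
        have "U s - U (r * s) \<le> (r powr \<alpha> - 1) * h (r * s)"
          using T[OF s] r by (intro upper) auto
        also have "\<dots> \<le> (r powr \<alpha> - 1) * (q * h s)" using T[OF s] d by (intro mult_left_mono) auto
        finally show "(r powr \<alpha> - 1) * q * - h s \<le> - U s - - U (r * s)" by simp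
      qed (use T t r q q0 d tendsto_minus[OF lim] in auto)
      then have "U t / h t \<le> (r powr \<alpha> - 1) * q / (1 - q)" using T[OF t] by (simp add: pos_divide_le_eq)
      then show "U t / h t < c" using q by linarith
    qed
  }
qed

section \<open>The Kendall kernel\<close>

text \<open>\<open>kendall_unit\<close> is given only by its values on sets, so the mixture formula
  is carried from indicators to integrals by induction over measurable functions.\<close>

lemma nn_integral_kendall_unit:
  assumes "f \<in> borel_measurable borel"
  shows "(\<integral>\<^sup>+u. f u \<partial>kendall_unit \<alpha> z) =
    ennreal (1 - z powr \<alpha>) * f 1 + ennreal (z powr \<alpha>) * (\<integral>\<^sup>+u. f u \<partial>pareto (2 * \<alpha>))"
  using assms
proof (induction rule: borel_measurable_induct)
  case (cong f g)
  then show ?case by (simp add: ext)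
next
  case (set A)
  then show ?case by (simp add: emeasure_kendall_unit)
next
  case (mult u c)
  then show ?case by (simp add: nn_integral_cmult algebra_simps)
next
  case (add u v)
  then show ?case by (simp add: nn_integral_add algebra_simps)
next
  case (seq U)
  note [measurable] = seq(1)
  have "(\<integral>\<^sup>+u. (\<Squnion> range U) u \<partial>kendall_unit \<alpha> z) = (SUP i. \<integral>\<^sup>+u. U i u \<partial>kendall_unit \<alpha> z)"
    unfolding SUP_apply using seq by (intro nn_integral_monotone_convergence_SUP) auto
  also have "\<dots> = (SUP i. ennreal (1 - z powr \<alpha>) * U i 1
      + ennreal (z powr \<alpha>) * (\<integral>\<^sup>+u. U i u \<partial>pareto (2 * \<alpha>)))"
    using seq by simp
  also have "\<dots> = ennreal (1 - z powr \<alpha>) * (SUP i. U i 1)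
      + ennreal (z powr \<alpha>) * (SUP i. \<integral>\<^sup>+u. U i u \<partial>pareto (2 * \<alpha>))"
    using \<open>incseq U\<close>
    by (subst ennreal_SUP_add)
      (auto simp: SUP_mult_left_ennreal incseq_def le_fun_def intro!: mult_left_mono nn_integral_mono)
  also have "(SUP i. \<integral>\<^sup>+u. U i u \<partial>pareto (2 * \<alpha>)) = (\<integral>\<^sup>+u. (\<Squnion> range U) u \<partial>pareto (2 * \<alpha>))"
    unfolding SUP_apply using seq by (intro nn_integral_monotone_convergence_SUP[symmetric]) auto
  finally show ?case by (simp add: SUP_apply image_comp)
qed

lemma nn_integral_kendall_kernel:
  assumes [measurable]: "f \<in> borel_measurable borel" and "0 \<le> x" "0 \<le> y" "0 < max x y"
  shows "(\<integral>\<^sup>+u. f u \<partial>kendall_kernel \<alpha> x y) =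
    ennreal (1 - (min x y / max x y) powr \<alpha>) * f (max x y)
    + ennreal ((min x y / max x y) powr \<alpha>) * (\<integral>\<^sup>+u. f (max x y * u) \<partial>pareto (2 * \<alpha>))"
  using assms(2-) by (simp add: kendall_kernel_def nn_integral_distr nn_integral_kendall_unit)

lemma nn_integral_pareto_eq_0:
  assumes "f \<in> borel_measurable borel" "\<And>u. 1 \<le> u \<Longrightarrow> f u = 0"
  shows "(\<integral>\<^sup>+u. f u \<partial>pareto \<beta>) = 0"
proof -
  have "AE u in pareto \<beta>. f u = 0"
    unfolding pareto_def using assms
    by (subst AE_density) (auto simp: indicator_def intro!: AE_I2 split: if_splits)
  then show ?thesis by (simp cong: nn_integral_cong_AE)
qed

text \<open>The cut-off at c leaves an integral over the compact interval from 1 to c, so the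
  fundamental theorem of calculus applies as soon as an antiderivative \<open>P\<close> of the
  density times \<open>g\<close> is supplied.\<close>

lemma nn_integral_pareto_atMost:
  assumes "0 < \<beta>" "1 \<le> c" and [measurable]: "g \<in> borel_measurable borel"
    and "\<And>u. 1 \<le> u \<Longrightarrow> u \<le> c \<Longrightarrow> 0 \<le> g u"
    and D: "\<And>u. 1 \<le> u \<Longrightarrow> u \<le> c \<Longrightarrow> (P has_real_derivative \<beta> * u powr (- \<beta> - 1) * g u) (at u)"
  shows "(\<integral>\<^sup>+u. ennreal (if u \<le> c then g u else 0) \<partial>pareto \<beta>) = ennreal (P c - P 1)"
proof -
  have "(\<integral>\<^sup>+u. ennreal (if u \<le> c then g u else 0) \<partial>pareto \<beta>)
      = (\<integral>\<^sup>+u. ennreal (\<beta> * u powr (- \<beta> - 1)) * indicator {1..} u * ennreal (if u \<le> c then g u else 0) \<partial>lborel)"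
    unfolding pareto_def by (subst nn_integral_density) auto
  also have "\<dots> = (\<integral>\<^sup>+u. ennreal (\<beta> * u powr (- \<beta> - 1) * g u) * indicator {1..c} u \<partial>lborel)"
    using assms by (intro nn_integral_cong) (auto simp: indicator_def ennreal_mult)
  also have "\<dots> = ennreal (P c - P 1)"
    using assms by (intro nn_integral_FTC_Icc) auto
  finally show ?thesis .
qed

section \<open>Product formula for the Williamson function and the distribution function of the
  kernel\<close>

definition williamson :: "real \<Rightarrow> real \<Rightarrow> real \<Rightarrow> real" where
  "williamson \<alpha> t x = (if x \<le> t then 1 - (x / t) powr \<alpha> else 0)"

lemma williamson_measurable [measurable]: "williamson \<alpha> t \<in> borel_measurable borel"
  unfolding williamson_def[abs_def] by measurable

lemma williamson_bounds:
  assumes "0 < \<alpha>" "0 < t" "0 \<le> x"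
  shows "0 \<le> williamson \<alpha> t x" "williamson \<alpha> t x \<le> 1"
  using assms by (auto simp: williamson_def intro!: powr_le1)

text \<open>With c = t/m the integral is (1 - c^(-2\<alpha>)) - 2 c^(-\<alpha>) (1 - c^(-\<alpha>)).
  The exponent 2\<alpha> of the Pareto law makes this a perfect square, and the square is what lets
  the mixture in the kernel factor.\<close>

lemma nn_integral_pareto_williamson:
  assumes "0 < \<alpha>" "0 < m" "m \<le> t"
  shows "(\<integral>\<^sup>+u. ennreal (williamson \<alpha> t (m * u)) \<partial>pareto (2 * \<alpha>)) = ennreal ((1 - (m / t) powr \<alpha>)\<^sup>2)"
proof -
  define c where "c = t / m"
  have c: "1 \<le> c" using assms by (simp add: c_def)
  have "(\<integral>\<^sup>+u. ennreal (williamson \<alpha> t (m * u)) \<partial>pareto (2 * \<alpha>))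
      = (\<integral>\<^sup>+u. ennreal (if u \<le> c then 1 - (u / c) powr \<alpha> else 0) \<partial>pareto (2 * \<alpha>))"
    using assms by (intro nn_integral_cong) (auto simp: williamson_def c_def field_simps)
  also have "\<dots> = ennreal ((2 * c powr (-\<alpha>) * c powr (-\<alpha>) - c powr (-(2*\<alpha>)))
       - (2 * c powr (-\<alpha>) * 1 powr (-\<alpha>) - 1 powr (-(2*\<alpha>))))"
  proof (rule nn_integral_pareto_atMost[where P = "\<lambda>u. 2 * c powr (-\<alpha>) * u powr (-\<alpha>) - u powr (-(2*\<alpha>))"])
    fix u assume u: "1 \<le> u" "u \<le> c"
    show "0 \<le> 1 - (u / c) powr \<alpha>" using u assms by (auto intro!: powr_le1)
    have "(u / c) powr \<alpha> = u powr \<alpha> * c powr (-\<alpha>)" using u by (simp add: powr_divide powr_minus_divide)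
    moreover have "u powr (- \<alpha> - 1) = u powr (- (2*\<alpha>) - 1) * u powr \<alpha>" by (simp flip: powr_add)
    ultimately have "- \<alpha> * u powr (- \<alpha> - 1) * (2 * c powr (-\<alpha>)) - - (2 * \<alpha>) * u powr (- (2*\<alpha>) - 1)
      = 2 * \<alpha> * u powr (- (2 * \<alpha>) - 1) * (1 - (u / c) powr \<alpha>)"
      by (simp add: algebra_simps)
    with u show "((\<lambda>u. 2 * c powr (-\<alpha>) * u powr (-\<alpha>) - u powr (-(2*\<alpha>))) has_real_derivative
      2 * \<alpha> * u powr (- (2 * \<alpha>) - 1) * (1 - (u / c) powr \<alpha>)) (at u)"
      by (auto intro!: derivative_eq_intros simp: mult_ac)
  qed (use assms c in auto)
  also have "(2 * c powr (-\<alpha>) * c powr (-\<alpha>) - c powr (-(2*\<alpha>)))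
       - (2 * c powr (-\<alpha>) * 1 powr (-\<alpha>) - 1 powr (-(2*\<alpha>))) = (1 - c powr (-\<alpha>))\<^sup>2"
    using powr_add[of c "-\<alpha>" "-\<alpha>"] by (simp add: power2_eq_square algebra_simps)
  also have "c powr (-\<alpha>) = (m / t) powr \<alpha>"
    using assms by (simp add: c_def powr_divide powr_minus_divide)
  finally show ?thesis .
qed

lemma nn_integral_pareto_indicator_atMost:
  assumes "0 < \<beta>" "0 < m" "m \<le> t"
  shows "(\<integral>\<^sup>+u. indicator {..t} (m * u) \<partial>pareto \<beta>) = ennreal (1 - (m / t) powr \<beta>)"
proof -
  have "(\<integral>\<^sup>+u. indicator {..t} (m * u) \<partial>pareto \<beta>)
      = (\<integral>\<^sup>+u. ennreal (if u \<le> t / m then 1 else 0) \<partial>pareto \<beta>)"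
    using assms by (intro nn_integral_cong) (auto simp: indicator_def field_simps)
  also have "\<dots> = ennreal (- ((t / m) powr (-\<beta>)) - - (1 powr (-\<beta>)))"
    using assms by (intro nn_integral_pareto_atMost[where P = "\<lambda>u. - (u powr (-\<beta>))"])
      (auto intro!: derivative_eq_intros)
  also have "(t / m) powr (-\<beta>) = (m / t) powr \<beta>"
    using assms by (simp add: powr_divide powr_minus_divide)
  finally show ?thesis by simp
qed

text \<open>With a = (m/t)^\<alpha> and b = (z/m)^\<alpha>, where m is the maximum and z the
  minimum, one has (z/t)^\<alpha> = ab and (1-b)(1-a) + b(1-a)^2 = (1-a)(1-ab). If m > t, both sides
  vanish, as the kernel lives on [m,\<infinity>). Thus \<open>williamson\<close> acts as a character
  of the Kendall convolution.\<close>

lemma nn_integral_kernel_williamson: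
  assumes \<alpha>: "0 < \<alpha>" "0 < t" "0 \<le> x" "0 \<le> y"
  shows "(\<integral>\<^sup>+u. ennreal (williamson \<alpha> t u) \<partial>kendall_kernel \<alpha> x y)
    = ennreal (williamson \<alpha> t x * williamson \<alpha> t y)"
proof (cases "0 < max x y")
  case False
  \<comment> \<open>The pair (0,0) falls into the default branch of \<open>kendall_kernel\<close>;
    its value, the unit mass at 0, is the correct one, and both sides equal 1.\<close>
  then have "x = 0" "y = 0" using assms by auto
  then show ?thesis using assms by (simp add: kendall_kernel_def nn_integral_return williamson_def)
next
  case True
  define m where "m = max x y"
  define z where "z = min x y"
  have m: "0 < m" "0 \<le> z" "z \<le> m" using True assms by (auto simp: m_def z_def)
  have prod: "williamson \<alpha> t x * williamson \<alpha> t y = williamson \<alpha> t m * williamson \<alpha> t z"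
    by (auto simp: m_def z_def max_def min_def)
  have "(\<integral>\<^sup>+u. ennreal (williamson \<alpha> t u) \<partial>kendall_kernel \<alpha> x y)
     = ennreal (1 - (z / m) powr \<alpha>) * ennreal (williamson \<alpha> t m)
       + ennreal ((z / m) powr \<alpha>) * (\<integral>\<^sup>+u. ennreal (williamson \<alpha> t (m * u)) \<partial>pareto (2 * \<alpha>))"
    unfolding m_def z_def using True assms by (intro nn_integral_kendall_kernel) auto
  also have "\<dots> = ennreal (williamson \<alpha> t m * williamson \<alpha> t z)"
  proof (cases "m \<le> t")
    case True
    have a: "0 \<le> 1 - (m / t) powr \<alpha>" "0 \<le> 1 - (z / m) powr \<alpha>"
      using assms m True by (auto intro!: powr_le1)
    have zt: "(z / t) powr \<alpha> = (z / m) powr \<alpha> * (m / t) powr \<alpha>"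
      using m assms by (simp flip: powr_mult)
    have "ennreal (1 - (z / m) powr \<alpha>) * ennreal (williamson \<alpha> t m)
       + ennreal ((z / m) powr \<alpha>) * (\<integral>\<^sup>+u. ennreal (williamson \<alpha> t (m * u)) \<partial>pareto (2 * \<alpha>))
       = ennreal ((1 - (z / m) powr \<alpha>) * (1 - (m / t) powr \<alpha>)
          + (z / m) powr \<alpha> * (1 - (m / t) powr \<alpha>)\<^sup>2)"
      using a True m assms
      by (subst nn_integral_pareto_williamson) (auto simp: williamson_def ennreal_mult)
    also have "(1 - (z / m) powr \<alpha>) * (1 - (m / t) powr \<alpha>)
          + (z / m) powr \<alpha> * (1 - (m / t) powr \<alpha>)\<^sup>2 = williamson \<alpha> t m * williamson \<alpha> t z"
      using True m by (simp add: williamson_def zt power2_eq_square algebra_simps)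
    finally show ?thesis .
  next
    case False
    have gt: "\<not> m * u \<le> t" if "1 \<le> u" for u
      using False m mult_left_mono[of 1 u m] that by linarith
    have "(\<integral>\<^sup>+u. ennreal (williamson \<alpha> t (m * u)) \<partial>pareto (2 * \<alpha>)) = 0"
      using gt by (intro nn_integral_pareto_eq_0) (auto simp: williamson_def)
    then show ?thesis using False by (simp add: williamson_def)
  qed
  finally show ?thesis by (simp add: prod)
qed

text \<open>In the same notation a = (m/t)^\<alpha>, b = (z/m)^\<alpha>, the mixture gives (1-b) +
  b(1-a^2) = 1 - (ab) a, and ab = (z/t)^\<alpha>; hence the symmetric form in x and y.\<close>

lemma emeasure_kernel_atMost:
  assumes \<alpha>: "0 < \<alpha>" "0 < t" "0 \<le> x" "0 \<le> y"
  shows "emeasure (kendall_kernel \<alpha> x y) {..t}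
    = ennreal (if x \<le> t \<and> y \<le> t then 1 - (x / t) powr \<alpha> * (y / t) powr \<alpha> else 0)"
proof (cases "0 < max x y")
  case False
  then have "x = 0" "y = 0" using assms by auto
  then show ?thesis using assms by (simp add: kendall_kernel_def)
next
  case True
  define m where "m = max x y"
  define z where "z = min x y"
  have m: "0 < m" "0 \<le> z" "z \<le> m" using True assms by (auto simp: m_def z_def)
  have prod: "(x / t) powr \<alpha> * (y / t) powr \<alpha> = (z / t) powr \<alpha> * (m / t) powr \<alpha>" "x \<le> t \<and> y \<le> t \<longleftrightarrow> m \<le> t"
    by (auto simp: m_def z_def max_def min_def)
  have "emeasure (kendall_kernel \<alpha> x y) {..t}
     = ennreal (1 - (z / m) powr \<alpha>) * indicator {..t} m
       + ennreal ((z / m) powr \<alpha>) * (\<integral>\<^sup>+u. indicator {..t} (m * u) \<partial>pareto (2 * \<alpha>))"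
    unfolding m_def z_def using True assms by (subst emeasure_kendall_kernel) auto
  also have "\<dots> = ennreal (if m \<le> t then 1 - (z / t) powr \<alpha> * (m / t) powr \<alpha> else 0)"
  proof (cases "m \<le> t")
    case True
    have a: "0 \<le> 1 - (m / t) powr (2*\<alpha>)" "0 \<le> 1 - (z / m) powr \<alpha>"
      using assms m True by (auto intro!: powr_le1)
    have zt: "(z / t) powr \<alpha> = (z / m) powr \<alpha> * (m / t) powr \<alpha>"
      using m assms by (simp flip: powr_mult)
    have "ennreal (1 - (z / m) powr \<alpha>) * indicator {..t} m
       + ennreal ((z / m) powr \<alpha>) * (\<integral>\<^sup>+u. indicator {..t} (m * u) \<partial>pareto (2 * \<alpha>))
       = ennreal ((1 - (z / m) powr \<alpha>) + (z / m) powr \<alpha> * (1 - (m / t) powr (2*\<alpha>)))"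
      using a True m assms by (simp add: nn_integral_pareto_indicator_atMost ennreal_mult)
    also have "(1 - (z / m) powr \<alpha>) + (z / m) powr \<alpha> * (1 - (m / t) powr (2*\<alpha>))
        = 1 - (z / t) powr \<alpha> * (m / t) powr \<alpha>"
      using powr_add[of "m / t" \<alpha> \<alpha>] by (simp add: zt algebra_simps)
    finally show ?thesis using True by simp
  next
    case False
    have gt: "\<not> m * u \<le> t" if "1 \<le> u" for u
      using False m mult_left_mono[of 1 u m] that by linarith
    have "(\<integral>\<^sup>+u. indicator {..t} (m * u) \<partial>pareto (2 * \<alpha>)) = 0"
      using gt by (intro nn_integral_pareto_eq_0) (auto simp: indicator_def)
    then show ?thesis using False by simp
  qed
  finally show ?thesis by (simp only: prod)
qed

section \<open>One step of the walk\<close>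

text \<open>The complement of \<open>williamson\<close>: the two add up to the indicator of x \<le>
  t. Its mean under \<nu> is the function h of the overview.\<close>

definition clipped_power :: "real \<Rightarrow> real \<Rightarrow> real \<Rightarrow> real" where
  "clipped_power \<alpha> t x = (if x \<le> t then (x / t) powr \<alpha> else 0)"

lemma clipped_power_measurable [measurable]: "clipped_power \<alpha> t \<in> borel_measurable borel"
  unfolding clipped_power_def[abs_def] by measurable

lemma clipped_power_bounds:
  assumes "0 < \<alpha>" "0 < t" "0 \<le> x"
  shows "0 \<le> clipped_power \<alpha> t x" "clipped_power \<alpha> t x \<le> 1"
  using assms by (auto simp: clipped_power_def intro!: powr_le1)

text \<open>Both bounds are equalities for x \<le> t and read 0 \<le> 0 for x > r t. In between, the
  increment is 1 - (x/(r t))^\<alpha>, which is nonnegative, and it is at most (r^\<alpha> - 1)(x/(r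
  t))^\<alpha> because (x/t)^\<alpha> \<ge> 1. Integrated over \<nu>, this is a difference form of
  the formal relation t G'(t) = \<alpha> h(t).\<close>

lemma williamson_increment:
  assumes "0 < \<alpha>" "0 < t" "1 < r" "0 \<le> x"
  shows "(1 - r powr (-\<alpha>)) * clipped_power \<alpha> t x \<le> williamson \<alpha> (r * t) x - williamson \<alpha> t x"
    and "williamson \<alpha> (r * t) x - williamson \<alpha> t x \<le> (r powr \<alpha> - 1) * clipped_power \<alpha> (r * t) x"
proof -
  have scale: "(x / (r * t)) powr \<alpha> = r powr (-\<alpha>) * (x / t) powr \<alpha>"
    using assms by (simp add: powr_divide powr_mult powr_minus_divide)
  have rr: "r powr \<alpha> * (r powr (-\<alpha>) * c) = c" for c
    using assms by (simp add: powr_minus)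
  have le: "x \<le> t \<Longrightarrow> x \<le> r * t" using mult_right_mono[of 1 r t] assms by linarith
  have top: "t < x \<Longrightarrow> 1 \<le> (x / t) powr \<alpha>" using assms by (intro ge_one_powr_ge_zero) auto
  have bot: "x \<le> r * t \<Longrightarrow> r powr (-\<alpha>) * (x / t) powr \<alpha> \<le> 1"
    unfolding scale[symmetric] using assms by (intro powr_le1) auto
  show "(1 - r powr (-\<alpha>)) * clipped_power \<alpha> t x \<le> williamson \<alpha> (r * t) x - williamson \<alpha> t x"
    using le bot by (auto simp: clipped_power_def williamson_def scale algebra_simps)
  show "williamson \<alpha> (r * t) x - williamson \<alpha> t x \<le> (r powr \<alpha> - 1) * clipped_power \<alpha> (r * t) x"
    using le top rr by (auto simp: clipped_power_def williamson_def scale left_diff_distrib rr)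
qed

section \<open>Transform and scaled truncated moment of the step law\<close>

definition williamson_transform :: "real \<Rightarrow> real measure \<Rightarrow> real \<Rightarrow> real" where
  "williamson_transform \<alpha> \<nu> t = (LINT x|\<nu>. williamson \<alpha> t x)"

definition scaled_moment :: "real \<Rightarrow> real measure \<Rightarrow> real \<Rightarrow> real" where
  "scaled_moment \<alpha> \<nu> t = (LINT x|\<nu>. clipped_power \<alpha> t x)"

locale kendall_step =
  fixes \<alpha> :: real and \<nu> :: "real measure"
  assumes \<alpha>_pos: "0 < \<alpha>" and \<nu>: "\<nu> \<in> nonneg_prob"
begin

abbreviation "G \<equiv> williamson_transform \<alpha> \<nu>"
abbreviation "h \<equiv> scaled_moment \<alpha> \<nu>"

sublocale prob_space \<nu> using \<nu> by (simp add: nonneg_prob_def)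

lemma sets_\<nu> [simp, measurable_cong]: "sets \<nu> = sets borel"
  and AE_nonneg: "AE x in \<nu>. 0 \<le> x"
  using \<nu> by (simp_all add: nonneg_prob_def)

lemma AE_nonnegI: "(\<And>x. 0 \<le> x \<Longrightarrow> P x) \<Longrightarrow> AE x in \<nu>. P x"
  using AE_nonneg by (auto elim!: eventually_mono)

lemma space_\<nu> [simp]: "space \<nu> = UNIV"
  using sets_eq_imp_space_eq[OF sets_\<nu>] by simp

lemma integrable_williamson: "0 < t \<Longrightarrow> integrable \<nu> (williamson \<alpha> t)"
  using AE_nonneg \<alpha>_pos
  by (intro integrable_const_bound[where B = 1]) (auto simp: williamson_bounds elim!: eventually_mono)

lemma integrable_clipped_power: "0 < t \<Longrightarrow> integrable \<nu> (clipped_power \<alpha> t)"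
  using AE_nonneg \<alpha>_pos
  by (intro integrable_const_bound[where B = 1]) (auto simp: clipped_power_bounds elim!: eventually_mono)

lemma transform_nonneg: "0 < t \<Longrightarrow> 0 \<le> G t" and scaled_moment_nonneg: "0 < t \<Longrightarrow> 0 \<le> h t"
  unfolding williamson_transform_def scaled_moment_def using AE_nonneg \<alpha>_pos
  by (auto intro!: integral_nonneg_AE simp: williamson_bounds clipped_power_bounds elim!: eventually_mono)

lemma nn_integral_williamson:
  assumes "0 < t" shows "(\<integral>\<^sup>+x. ennreal (williamson \<alpha> t x) \<partial>\<nu>) = ennreal (G t)"
  unfolding williamson_transform_def using AE_nonneg \<alpha>_pos assms integrable_williamson
  by (intro nn_integral_eq_integral) (auto simp: williamson_bounds elim!: eventually_mono)

lemma nn_integral_clipped_power: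
  assumes "0 < t" shows "(\<integral>\<^sup>+x. ennreal (clipped_power \<alpha> t x) \<partial>\<nu>) = ennreal (h t)"
  unfolding scaled_moment_def using AE_nonneg \<alpha>_pos assms integrable_clipped_power
  by (intro nn_integral_eq_integral) (auto simp: clipped_power_bounds elim!: eventually_mono)

lemma scaled_moment_eq:
  assumes "0 < t" shows "h t = t powr (-\<alpha>) * truncated_moment \<alpha> \<nu> t"
proof -
  have "h t = (LINT x|\<nu>. t powr (-\<alpha>) * (indicator {0..t} x * x powr \<alpha>))"
    unfolding scaled_moment_def using AE_nonneg assms
    by (intro integral_cong_AE)
      (auto simp: clipped_power_def indicator_def powr_divide powr_minus_divide elim!: eventually_mono)
  then show ?thesis by (simp add: truncated_moment_def set_lebesgue_integral_def)
qed

lemma transform_increment: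
  assumes "0 < t" "1 < r"
  shows "(1 - r powr (-\<alpha>)) * h t \<le> G (r * t) - G t"
    and "G (r * t) - G t \<le> (r powr \<alpha> - 1) * h (r * t)"
proof -
  have "0 < r * t" using assms by simp
  note I = integrable_williamson[OF this] integrable_williamson[OF assms(1)]
    integrable_clipped_power[OF this] integrable_clipped_power[OF assms(1)]
  have D: "G (r * t) - G t = (LINT x|\<nu>. williamson \<alpha> (r * t) x - williamson \<alpha> t x)"
    using I by (simp add: williamson_transform_def)
  have "(1 - r powr (-\<alpha>)) * h t = (LINT x|\<nu>. (1 - r powr (-\<alpha>)) * clipped_power \<alpha> t x)"
    by (simp add: scaled_moment_def)
  also have "\<dots> \<le> (LINT x|\<nu>. williamson \<alpha> (r * t) x - williamson \<alpha> t x)"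
    using I AE_nonneg \<alpha>_pos assms
    by (intro integral_mono_AE) (auto intro: williamson_increment elim!: eventually_mono)
  finally show "(1 - r powr (-\<alpha>)) * h t \<le> G (r * t) - G t" by (simp only: D)
  have "G (r * t) - G t \<le> (LINT x|\<nu>. (r powr \<alpha> - 1) * clipped_power \<alpha> (r * t) x)"
    unfolding D using I AE_nonneg \<alpha>_pos assms
    by (intro integral_mono_AE) (auto intro: williamson_increment elim!: eventually_mono)
  then show "G (r * t) - G t \<le> (r powr \<alpha> - 1) * h (r * t)" by (simp add: scaled_moment_def)
qed

lemma transform_tendsto_1: "(G \<longlongrightarrow> 1) at_top"
proof -
  have "((\<lambda>t. LINT x|\<nu>. williamson \<alpha> t x) \<longlongrightarrow> (LINT x|\<nu>. 1)) at_top"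
  proof (rule integral_dominated_convergence_at_top[where w = "\<lambda>_. 1"])
    show "\<forall>\<^sub>F t in at_top. AE x in \<nu>. norm (williamson \<alpha> t x) \<le> 1"
      using eventually_gt_at_top[of 0]
    proof eventually_elim
      case (elim t)
      with AE_nonneg \<alpha>_pos show ?case by (auto simp: williamson_bounds elim!: eventually_mono)
    qed
    show "AE x in \<nu>. ((\<lambda>t. williamson \<alpha> t x) \<longlongrightarrow> 1) at_top"
    proof (rule AE_nonnegI)
      fix x :: real assume "0 \<le> x"
      have "((\<lambda>t. 1 - (x / t) powr \<alpha>) \<longlongrightarrow> 1 - 0) at_top"
        using \<alpha>_pos \<open>0 \<le> x\<close> eventually_mono[OF eventually_gt_at_top[of 0], of "\<lambda>t. 0 \<le> x / t"]
        by (intro tendsto_intros tendsto_zero_powrI[where b = \<alpha>] real_tendsto_divide_at_top[where c = x]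
            filterlim_ident) auto
      then show "((\<lambda>t. williamson \<alpha> t x) \<longlongrightarrow> 1) at_top"
        using eventually_mono[OF eventually_ge_at_top[of x], of "\<lambda>t. 1 - (x / t) powr \<alpha> = williamson \<alpha> t x"]
        by (auto simp: williamson_def[abs_def] intro: Lim_transform_eventually)
    qed
  qed auto
  then show ?thesis using prob_space by (simp add: williamson_transform_def[abs_def])
qed

text \<open>The integrands sum to an indicator. The bound forces G t < 1 wherever h t > 0, which is
  the condition for the series over n to converge.\<close>

lemma scaled_moment_le:
  assumes "0 < t" shows "h t \<le> 1 - G t"
proof -
  have "h t + G t = (LINT x|\<nu>. clipped_power \<alpha> t x + williamson \<alpha> t x)"
    using assms by (simp add: scaled_moment_def williamson_transform_def
      integrable_clipped_power integrable_williamson)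
  also have "\<dots> \<le> (LINT x|\<nu>. 1)"
    using assms
    by (intro integral_mono Bochner_Integration.integrable_add integrable_clipped_power integrable_williamson)
      (auto simp: clipped_power_def williamson_def)
  finally show ?thesis using prob_space by simp
qed

lemma emeasure_atMost:
  assumes "0 < t" shows "emeasure \<nu> {..t} = ennreal (G t + h t)"
proof -
  have "emeasure \<nu> {..t} = (\<integral>\<^sup>+x. indicator {..t} x \<partial>\<nu>)" by simp
  also have "\<dots> = (\<integral>\<^sup>+x. ennreal (williamson \<alpha> t x) + ennreal (clipped_power \<alpha> t x) \<partial>\<nu>)"
  proof (rule nn_integral_cong_AE, rule AE_nonnegI)
    fix x :: real assume "0 \<le> x"
    with assms \<alpha>_pos show "indicator {..t} x = ennreal (williamson \<alpha> t x) + ennreal (clipped_power \<alpha> t x)"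
      by (subst ennreal_plus[symmetric])
        (auto simp: williamson_def clipped_power_def intro!: powr_le1)
  qed
  also have "\<dots> = ennreal (G t + h t)"
    using assms by (simp add: nn_integral_add nn_integral_williamson nn_integral_clipped_power
      transform_nonneg scaled_moment_nonneg)
  finally show ?thesis .
qed

section \<open>Transition kernel of one step and its action on the two test functions\<close>

definition step_kernel :: "real \<Rightarrow> real measure" where
  "step_kernel x = \<nu> \<bind> kendall_kernel \<alpha> x"

lemma \<nu>_in: "\<nu> \<in> space (prob_algebra borel)"
  using \<nu> by (rule nonneg_prob_in_prob_algebra)

lemma kernel_measurable [measurable]:
  "(\<lambda>y. kendall_kernel \<alpha> x y) \<in> borel \<rightarrow>\<^sub>M prob_algebra borel"
  using measurable_compose[OF measurable_Pair1' measurable_kendall_kernel[OF \<alpha>_pos], of x] by simp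

lemma step_kernel_measurable [measurable]: "step_kernel \<in> borel \<rightarrow>\<^sub>M prob_algebra borel"
  unfolding step_kernel_def[abs_def] using \<nu>_in measurable_kendall_kernel[OF \<alpha>_pos]
  by (intro measurable_bind_prob_space2[where N = borel]) simp_all

lemma nn_integral_step_kernel:
  assumes "f \<in> borel_measurable borel"
  shows "(\<integral>\<^sup>+u. f u \<partial>step_kernel x) = (\<integral>\<^sup>+y. \<integral>\<^sup>+u. f u \<partial>kendall_kernel \<alpha> x y \<partial>\<nu>)"
  unfolding step_kernel_def using assms
  by (intro nn_integral_bind[where B = borel]) (auto intro!: measurable_prob_algebraD)

text \<open>The recursion starts from the unit mass at 0, so the first power is \<nu> convolved with
  it and has to be reduced by neutrality. For x > 0 the ratio min/max is 0 and the kernel puts all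
  its mass at x; x = 0 is the default branch. Negative x would be sent to 0, hence the restriction
  to almost every x.\<close>

lemma kendall_power_1: "kendall_power \<alpha> \<nu> (Suc 0) = \<nu>"
proof (rule measure_eqI)
  have 0: "return borel (0::real) \<in> nonneg_prob"
    by (auto simp: nonneg_prob_def AE_return intro!: prob_space_return)
  show S: "sets (kendall_power \<alpha> \<nu> (Suc 0)) = sets \<nu>"
    by (simp add: kendall_conv_def sets_bind[where N = borel] space_\<nu>)
  fix A assume "A \<in> sets (kendall_power \<alpha> \<nu> (Suc 0))"
  then have [measurable]: "A \<in> sets borel" using S by simp
  have "emeasure (kendall_power \<alpha> \<nu> (Suc 0)) A
      = (\<integral>\<^sup>+x. \<integral>\<^sup>+y. emeasure (kendall_kernel \<alpha> x y) A \<partial>return borel 0 \<partial>\<nu>)"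
    using emeasure_kendall_conv[OF \<alpha>_pos \<nu> 0] by simp
  also have "\<dots> = (\<integral>\<^sup>+x. indicator A x \<partial>\<nu>)"
  proof (rule nn_integral_cong_AE, rule AE_nonnegI)
    fix x :: real assume "0 \<le> x"
    have "(\<lambda>y. emeasure (kendall_kernel \<alpha> x y) A) \<in> borel_measurable borel"
      by (rule measurable_compose[OF measurable_prob_algebraD[OF kernel_measurable]
          measurable_emeasure_subprob_algebra]) simp
    then have "(\<integral>\<^sup>+y. emeasure (kendall_kernel \<alpha> x y) A \<partial>return borel 0) = emeasure (kendall_kernel \<alpha> x 0) A"
      by (simp add: nn_integral_return)
    also have "\<dots> = indicator A x"
      using \<open>0 \<le> x\<close> \<alpha>_pos by (cases "x = 0") (auto simp: emeasure_kendall_kernel)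
    finally show "(\<integral>\<^sup>+y. emeasure (kendall_kernel \<alpha> x y) A \<partial>return borel 0) = indicator A x" .
  qed
  finally show "emeasure (kendall_power \<alpha> \<nu> (Suc 0)) A = emeasure \<nu> A" by simp
qed

lemma kendall_conv_return: "kendall_conv \<alpha> (return borel x) \<nu> = step_kernel x"
proof -
  have "kendall_conv \<alpha> (return borel x) \<nu> = return borel x \<bind> step_kernel"
    by (simp add: kendall_conv_def step_kernel_def[abs_def])
  also have "\<dots> = step_kernel x"
    by (rule bind_return[of _ _ borel]) (auto intro!: measurable_prob_algebraD)
  finally show ?thesis .
qed

lemma nn_integral_step_williamson:
  assumes "0 < t" "0 \<le> x"
  shows "(\<integral>\<^sup>+u. ennreal (williamson \<alpha> t u) \<partial>step_kernel x) = ennreal (G t) * ennreal (williamson \<alpha> t x)"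
proof -
  have "(\<integral>\<^sup>+u. ennreal (williamson \<alpha> t u) \<partial>step_kernel x)
      = (\<integral>\<^sup>+y. \<integral>\<^sup>+u. ennreal (williamson \<alpha> t u) \<partial>kendall_kernel \<alpha> x y \<partial>\<nu>)"
    by (rule nn_integral_step_kernel) simp
  also have "\<dots> = (\<integral>\<^sup>+y. ennreal (williamson \<alpha> t x) * ennreal (williamson \<alpha> t y) \<partial>\<nu>)"
    using AE_nonneg assms \<alpha>_pos
    by (intro nn_integral_cong_AE)
      (auto simp: nn_integral_kernel_williamson ennreal_mult williamson_bounds elim!: eventually_mono)
  also have "\<dots> = ennreal (G t) * ennreal (williamson \<alpha> t x)"
    using assms by (simp add: nn_integral_cmult nn_integral_williamson) (simp add: mult.commute)
  finally show ?thesis .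
qed

text \<open>With a = (x/t)^\<alpha> and b = (y/t)^\<alpha> the kernel mass 1 - ab is split as (1-b)
  + (1-a) b. Each summand separates x from y, and integrating over y turns 1-b into G t and b into h
  t.\<close>

lemma nn_integral_step_kernel_atMost:
  assumes "0 < t" "0 \<le> x"
  shows "(\<integral>\<^sup>+u. indicator {..t} u \<partial>step_kernel x)
    = ennreal (G t) * indicator {..t} x + ennreal (h t) * ennreal (williamson \<alpha> t x)"
proof -
  have "(\<integral>\<^sup>+u. indicator {..t} u \<partial>step_kernel x)
      = (\<integral>\<^sup>+y. \<integral>\<^sup>+u. indicator {..t} u \<partial>kendall_kernel \<alpha> x y \<partial>\<nu>)"
    by (rule nn_integral_step_kernel) simp
  also have "\<dots> = (\<integral>\<^sup>+y. indicator {..t} x * ennreal (williamson \<alpha> t y)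
      + ennreal (williamson \<alpha> t x) * ennreal (clipped_power \<alpha> t y) \<partial>\<nu>)"
  proof (rule nn_integral_cong_AE, rule AE_nonnegI)
    fix y :: real assume y: "0 \<le> y"
    have "(\<integral>\<^sup>+u. indicator {..t} u \<partial>kendall_kernel \<alpha> x y)
        = ennreal (if x \<le> t \<and> y \<le> t then 1 - (x / t) powr \<alpha> * (y / t) powr \<alpha> else 0)"
      using emeasure_kernel_atMost[OF \<alpha>_pos assms y] by simp
    also have "\<dots> = ennreal (indicator {..t} x * williamson \<alpha> t y + williamson \<alpha> t x * clipped_power \<alpha> t y)"
      by (simp add: williamson_def clipped_power_def indicator_def algebra_simps)
    also have "\<dots> = indicator {..t} x * ennreal (williamson \<alpha> t y)
      + ennreal (williamson \<alpha> t x) * ennreal (clipped_power \<alpha> t y)"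
      using williamson_bounds[OF \<alpha>_pos assms] williamson_bounds[OF \<alpha>_pos assms(1) y]
        clipped_power_bounds[OF \<alpha>_pos assms(1) y]
      by (simp add: ennreal_mult indicator_def)
    finally show "(\<integral>\<^sup>+u. indicator {..t} u \<partial>kendall_kernel \<alpha> x y) = \<dots>" .
  qed
  also have "\<dots> = ennreal (G t) * indicator {..t} x + ennreal (h t) * ennreal (williamson \<alpha> t x)"
    using assms by (simp add: nn_integral_cmult nn_integral_add nn_integral_williamson
      nn_integral_clipped_power) (simp add: mult.commute)
  finally show ?thesis .
qed

end

section \<open>The walk and its renewal function\<close>

text \<open>The process records the index n of S_(n+1), so exceeding n constrains n+1 variables. The
  strict form is the one that occurs in the tail-sum formula for the expectation.\<close>

lemma renewal_process_gt_iff: "enat n < renewal_process S t \<omega> \<longleftrightarrow> (\<forall>m\<in>{1..Suc n}. S m \<omega> \<le> t)"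
proof -
  have "enat n < renewal_process S t \<omega> \<longleftrightarrow> enat (Suc n) \<le> renewal_process S t \<omega>"
    by (simp add: Suc_ile_eq)
  also have "\<dots> \<longleftrightarrow> (\<forall>m. S (Suc m) \<omega> > t \<longrightarrow> Suc n \<le> m)"
    by (auto simp: renewal_process_def le_Inf_iff)
  also have "\<dots> \<longleftrightarrow> (\<forall>m\<in>{1..Suc n}. S m \<omega> \<le> t)"
  proof safe
    fix m assume *: "\<forall>m. t < S (Suc m) \<omega> \<longrightarrow> Suc n \<le> m" "m \<in> {1..Suc n}"
    then obtain k where "m = Suc k" "k \<le> n" by (cases m) auto
    then show "S m \<omega> \<le> t" using *(1)[rule_format, of k] by (cases "t < S m \<omega>") auto
  next
    fix m assume "\<forall>m\<in>{1..Suc n}. S m \<omega> \<le> t" "t < S (Suc m) \<omega>"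
    then have "Suc m \<notin> {1..Suc n}" by (meson not_less)
    then show "Suc n \<le> m" by simp
  qed
  finally show ?thesis .
qed

locale kendall_walk = kendall_step \<alpha> \<nu> for \<alpha> \<nu> +
  fixes M :: "'w measure" and S :: "nat \<Rightarrow> 'w \<Rightarrow> real"
  assumes walk: "kendall_random_walk \<alpha> \<nu> M S"
begin

sublocale W: prob_space M using walk[unfolded kendall_random_walk_def] by (rule conjunct1)

lemma S_measurable [measurable]: "1 \<le> n \<Longrightarrow> S n \<in> borel_measurable M"
  and S_nonneg: "1 \<le> n \<Longrightarrow> \<omega> \<in> space M \<Longrightarrow> 0 \<le> S n \<omega>"
  and distr_S_1: "distr M borel (S 1) = \<nu>"
  using walk[unfolded kendall_random_walk_def, THEN conjunct2, THEN conjunct1]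
    walk[unfolded kendall_random_walk_def, THEN conjunct2, THEN conjunct2, THEN conjunct1]
  by blast+

lemma markov_property:
  assumes "1 \<le> k" "k < n" "A \<in> sets borel"
  shows "AE \<omega> in M. real_cond_exp M (past_sigma M S k) (\<lambda>\<omega>. indicator A (S n \<omega>)) \<omega>
    = measure (kendall_conv \<alpha> (return borel (S k \<omega>)) (kendall_power \<alpha> \<nu> (n - k))) A"
  using walk[unfolded kendall_random_walk_def, THEN conjunct2, THEN conjunct2, THEN conjunct2,
    rule_format, OF assms] .

section \<open>The Markov property in integrated form\<close>

lemma space_past_sigma [simp]: "space (past_sigma M S k) = space M"
  unfolding past_sigma_def by (rule space_measure_of) auto

lemma sets_past_sigma:
  "sets (past_sigma M S k)
    = sigma_sets (space M) {S i -` B \<inter> space M | i B. 1 \<le> i \<and> i \<le> k \<and> B \<in> sets borel}"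
  unfolding past_sigma_def by (rule sets_measure_of) auto

lemma subalgebra_past_sigma: "subalgebra M (past_sigma M S k)"
proof -
  have "{S i -` B \<inter> space M | i B. 1 \<le> i \<and> i \<le> k \<and> B \<in> sets borel} \<subseteq> sets M"
    using measurable_sets[OF S_measurable] by blast
  from sets.sigma_sets_subset[OF this] show ?thesis
    by (simp only: subalgebra_def sets_past_sigma space_past_sigma simp_thms)
qed

lemma past_sigma_event:
  "1 \<le> i \<Longrightarrow> i \<le> k \<Longrightarrow> {\<omega> \<in> space M. S i \<omega> \<le> t} \<in> sets (past_sigma M S k)"
  unfolding sets_past_sigma
proof (rule sigma_sets.Basic, rule CollectI, intro exI conjI)
  show "{\<omega> \<in> space M. S i \<omega> \<le> t} = S i -` {..t} \<inter> space M" by auto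
qed auto

text \<open>The conditional law is known outside a null set that may depend on A. Integration over
  an event B of the past removes the null set and leaves an identity of numbers, valid for every
  Borel set A.\<close>

lemma markov_emeasure:
  assumes B: "B \<in> sets (past_sigma M S k)" and k: "1 \<le> k" and A: "A \<in> sets borel"
  shows "(\<integral>\<^sup>+\<omega>. indicator B \<omega> * indicator A (S (Suc k) \<omega>) \<partial>M)
    = (\<integral>\<^sup>+\<omega>. indicator B \<omega> * emeasure (step_kernel (S k \<omega>)) A \<partial>M)"
proof -
  note [measurable] = A S_measurable[OF k]
  have S1 [measurable]: "S (Suc k) \<in> borel_measurable M" by simp
  have B' [measurable]: "B \<in> sets M"
    using B subalgebra_past_sigma unfolding subalgebra_def by auto
  interpret F: finite_measure_subalgebra M "past_sigma M S k"
    using subalgebra_past_sigma by unfold_locales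
  define c where "c = real_cond_exp M (past_sigma M S k) (\<lambda>\<omega>. indicator A (S (Suc k) \<omega>))"
  have c: "AE \<omega> in M. c \<omega> = measure (step_kernel (S k \<omega>)) A"
  proof -
    have "AE \<omega> in M. c \<omega>
        = measure (kendall_conv \<alpha> (return borel (S k \<omega>)) (kendall_power \<alpha> \<nu> (Suc k - k))) A"
      unfolding c_def using k A by (intro markov_property) auto
    moreover have "Suc k - k = Suc 0" by simp
    ultimately show ?thesis by (simp only: kendall_power_1 kendall_conv_return)
  qed
  have P: "prob_space (step_kernel x)" "sets (step_kernel x) = sets borel" for x
    using measurable_space[OF step_kernel_measurable, of x] by (auto simp: space_prob_algebra)
  have m [measurable]: "(\<lambda>\<omega>. measure (step_kernel (S k \<omega>)) A) \<in> borel_measurable M"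
    by (rule measurable_compose[OF measurable_compose[OF S_measurable[OF k]
          measurable_prob_algebraD[OF step_kernel_measurable]] measurable_measure_subprob_algebra]) simp
  have int1: "integrable M (\<lambda>\<omega>. indicator A (S (Suc k) \<omega>) :: real)"
    by (intro W.integrable_const_bound[where B = 1]) (auto simp: indicator_def)
  have int2: "integrable M (\<lambda>\<omega>. indicator B \<omega> * indicator A (S (Suc k) \<omega>) :: real)"
    by (intro W.integrable_const_bound[where B = 1]) (auto simp: indicator_def)
  have int3: "integrable M (\<lambda>\<omega>. indicator B \<omega> * measure (step_kernel (S k \<omega>)) A)"
    using P by (intro W.integrable_const_bound[where B = 1])
      (auto simp: indicator_def prob_space.prob_le_1)
  have "(\<integral>\<^sup>+\<omega>. indicator B \<omega> * indicator A (S (Suc k) \<omega>) \<partial>M)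
      = (\<integral>\<^sup>+\<omega>. ennreal (indicator B \<omega> * indicator A (S (Suc k) \<omega>)) \<partial>M)"
    by (intro nn_integral_cong) (auto simp: indicator_def)
  also have "\<dots> = ennreal (LINT \<omega>|M. indicator B \<omega> * indicator A (S (Suc k) \<omega>))"
    using int2 by (intro nn_integral_eq_integral) auto
  \<comment> \<open>This is the defining property of the conditional expectation, available because
    B belongs to the past.\<close>
  also have "(LINT \<omega>|M. indicator B \<omega> * indicator A (S (Suc k) \<omega>)) = (LINT \<omega>:B|M. c \<omega>)"
    using F.real_cond_exp_intA[OF int1 B] by (simp add: set_lebesgue_integral_def c_def)
  also have "\<dots> = (LINT \<omega>|M. indicator B \<omega> * measure (step_kernel (S k \<omega>)) A)"
    unfolding set_lebesgue_integral_def using c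
    by (intro integral_cong_AE) (auto simp: c_def elim!: eventually_mono)
  also have "ennreal \<dots> = (\<integral>\<^sup>+\<omega>. ennreal (indicator B \<omega> * measure (step_kernel (S k \<omega>)) A) \<partial>M)"
    using int3 by (intro nn_integral_eq_integral[symmetric]) auto
  also have "\<dots> = (\<integral>\<^sup>+\<omega>. indicator B \<omega> * emeasure (step_kernel (S k \<omega>)) A \<partial>M)"
    using P by (intro nn_integral_cong)
      (auto simp: indicator_def finite_measure.emeasure_eq_measure[OF prob_space.finite_measure])
  finally show ?thesis .
qed

text \<open>For fixed B, the identity of \<open>markov_emeasure\<close> for all A says that two
  measures on the line coincide: the law of \<open>S (Suc k)\<close> under M restricted to B, and
  the restricted M pushed through the step kernel. Equal measures integrate every f alike.\<close>

lemma markov_nn_integral: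
  assumes B: "B \<in> sets (past_sigma M S k)" and k: "1 \<le> k"
    and f [measurable]: "f \<in> borel_measurable borel"
  shows "(\<integral>\<^sup>+\<omega>. indicator B \<omega> * f (S (Suc k) \<omega>) \<partial>M)
    = (\<integral>\<^sup>+\<omega>. indicator B \<omega> * (\<integral>\<^sup>+u. f u \<partial>step_kernel (S k \<omega>)) \<partial>M)"
proof -
  note [measurable] = S_measurable[OF k]
  have S1 [measurable]: "S (Suc k) \<in> borel_measurable M" by simp
  have B' [measurable]: "B \<in> sets M"
    using B subalgebra_past_sigma unfolding subalgebra_def by auto
  let ?D = "density M (indicator B)"
  have K: "(\<lambda>\<omega>. step_kernel (S k \<omega>)) \<in> ?D \<rightarrow>\<^sub>M subprob_algebra borel"
    by (intro measurable_prob_algebraD) simp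
  have K': "(\<lambda>\<omega>. step_kernel (S k \<omega>)) \<in> M \<rightarrow>\<^sub>M subprob_algebra borel"
    using K by simp
  have "distr ?D borel (S (Suc k)) = ?D \<bind> (\<lambda>\<omega>. step_kernel (S k \<omega>))"
  proof (rule measure_eqI)
    show "sets (distr ?D borel (S (Suc k))) = sets (?D \<bind> (\<lambda>\<omega>. step_kernel (S k \<omega>)))"
      using sets_bind_measurable[OF K] W.not_empty by simp
    fix A assume "A \<in> sets (distr ?D borel (S (Suc k)))"
    then have A [measurable]: "A \<in> sets borel" by simp
    have "emeasure (distr ?D borel (S (Suc k))) A = (\<integral>\<^sup>+\<omega>. indicator A \<omega> \<partial>distr ?D borel (S (Suc k)))"
      by simp
    also have "\<dots> = (\<integral>\<^sup>+\<omega>. indicator B \<omega> * indicator A (S (Suc k) \<omega>) \<partial>M)"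
      by (subst nn_integral_distr, measurable, subst nn_integral_density, measurable)
    also have "\<dots> = (\<integral>\<^sup>+\<omega>. indicator B \<omega> * emeasure (step_kernel (S k \<omega>)) A \<partial>M)"
      by (rule markov_emeasure[OF B k A])
    also have "\<dots> = (\<integral>\<^sup>+\<omega>. emeasure (step_kernel (S k \<omega>)) A \<partial>?D)"
      by (subst nn_integral_density) (auto intro!: measurable_emeasure_kernel[OF K' A])
    also have "\<dots> = emeasure (?D \<bind> (\<lambda>\<omega>. step_kernel (S k \<omega>))) A"
      using W.not_empty by (intro emeasure_bind[OF _ K A, symmetric]) simp
    finally show "emeasure (distr ?D borel (S (Suc k))) A = emeasure (?D \<bind> (\<lambda>\<omega>. step_kernel (S k \<omega>))) A" .
  qed
  then have "(\<integral>\<^sup>+u. f u \<partial>distr ?D borel (S (Suc k))) = (\<integral>\<^sup>+u. f u \<partial>(?D \<bind> (\<lambda>\<omega>. step_kernel (S k \<omega>))))"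
    by simp
  also have "\<dots> = (\<integral>\<^sup>+\<omega>. (\<integral>\<^sup>+u. f u \<partial>step_kernel (S k \<omega>)) \<partial>?D)"
    by (rule nn_integral_bind[OF f K])
  also have "\<dots> = (\<integral>\<^sup>+\<omega>. indicator B \<omega> * (\<integral>\<^sup>+u. f u \<partial>step_kernel (S k \<omega>)) \<partial>M)"
    by (subst nn_integral_density)
      (auto intro!: measurable_compose[OF K' nn_integral_measurable_subprob_algebra])
  also have "(\<integral>\<^sup>+u. f u \<partial>distr ?D borel (S (Suc k))) = (\<integral>\<^sup>+\<omega>. indicator B \<omega> * f (S (Suc k) \<omega>) \<partial>M)"
    by (subst nn_integral_distr, measurable, subst nn_integral_density, measurable)
  finally show ?thesis .
qed

section \<open>Survival below a level and the renewal function\<close>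

definition below :: "real \<Rightarrow> nat \<Rightarrow> 'w set" where
  "below t n = {\<omega> \<in> space M. \<forall>m\<in>{1..n}. S m \<omega> \<le> t}"

lemma below_past: "below t n \<in> sets (past_sigma M S n)"
proof -
  have "{\<omega> \<in> space (past_sigma M S n). \<forall>m\<in>{1..n}. S m \<omega> \<le> t} \<in> sets (past_sigma M S n)"
    using past_sigma_event by (intro sets.sets_Collect_finite_All) auto
  then show ?thesis by (simp add: below_def)
qed

lemma below_measurable [measurable]: "below t n \<in> sets M"
  using below_past subalgebra_past_sigma unfolding subalgebra_def by blast

lemma nn_integral_below_williamson:
  assumes t: "0 < t"
  shows "(\<integral>\<^sup>+\<omega>. indicator (below t (Suc n)) \<omega> * ennreal (williamson \<alpha> t (S (Suc n) \<omega>)) \<partial>M)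
    = ennreal (G t ^ Suc n)"
proof (induction n)
  case 0
  have "(\<integral>\<^sup>+\<omega>. indicator (below t (Suc 0)) \<omega> * ennreal (williamson \<alpha> t (S (Suc 0) \<omega>)) \<partial>M)
      = (\<integral>\<^sup>+\<omega>. ennreal (williamson \<alpha> t (S 1 \<omega>)) \<partial>M)"
    by (intro nn_integral_cong) (auto simp: below_def williamson_def indicator_def)
  also have "\<dots> = (\<integral>\<^sup>+x. ennreal (williamson \<alpha> t x) \<partial>distr M borel (S 1))"
    by (subst nn_integral_distr) auto
  finally show ?case using t by (simp add: distr_S_1[simplified] nn_integral_williamson)
next
  case (Suc n)
  have "(\<integral>\<^sup>+\<omega>. indicator (below t (Suc (Suc n))) \<omega> * ennreal (williamson \<alpha> t (S (Suc (Suc n)) \<omega>)) \<partial>M)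
      = (\<integral>\<^sup>+\<omega>. indicator (below t (Suc n)) \<omega> * ennreal (williamson \<alpha> t (S (Suc (Suc n)) \<omega>)) \<partial>M)"
    \<comment> \<open>\<open>williamson\<close> vanishes above t, so the constraint on the last
      index may be dropped under the integral; the event left over belongs to the past of the last
      step, as the Markov identity requires.\<close>
    by (intro nn_integral_cong)
      (auto simp: below_def williamson_def indicator_def atLeastAtMostSuc_conv)
  also have "\<dots> = (\<integral>\<^sup>+\<omega>. indicator (below t (Suc n)) \<omega>
      * (\<integral>\<^sup>+u. ennreal (williamson \<alpha> t u) \<partial>step_kernel (S (Suc n) \<omega>)) \<partial>M)"
    by (intro markov_nn_integral below_past) auto
  also have "\<dots> = (\<integral>\<^sup>+\<omega>. ennreal (G t) * (indicator (below t (Suc n)) \<omega> * ennreal (williamson \<alpha> t (S (Suc n) \<omega>))) \<partial>M)"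
    using t by (intro nn_integral_cong) (simp add: nn_integral_step_williamson S_nonneg mult_ac)
  also have "\<dots> = ennreal (G t) * ennreal (G t ^ Suc n)"
    by (subst nn_integral_cmult) (auto simp: Suc)
  also have "\<dots> = ennreal (G t ^ Suc (Suc n))"
    using transform_nonneg[OF t] by (simp add: ennreal_mult)
  finally show ?case .
qed

text \<open>With a_k for the probability of \<open>below t k\<close>, the one-step formula gives
  a_(k+1) = G a_k + h G^k and a_1 = G + h. Starting the index at \<open>Suc n\<close> writes the
  exponent of the second term without a subtraction on naturals.\<close>

lemma emeasure_below:
  assumes t: "0 < t"
  shows "emeasure M (below t (Suc n)) = ennreal (G t ^ Suc n + real (Suc n) * h t * G t ^ n)"
proof (induction n)
  case 0
  have "emeasure M (below t (Suc 0)) = emeasure (distr M borel (S 1)) {..t}"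
    by (subst emeasure_distr) (auto simp: below_def intro!: arg_cong[where f = "emeasure M"])
  then show ?case using t by (simp add: distr_S_1[simplified] emeasure_atMost)
next
  case (Suc n)
  have "emeasure M (below t (Suc (Suc n))) = (\<integral>\<^sup>+\<omega>. indicator (below t (Suc (Suc n))) \<omega> \<partial>M)"
    by simp
  also have "\<dots> = (\<integral>\<^sup>+\<omega>. indicator (below t (Suc n)) \<omega> * indicator {..t} (S (Suc (Suc n)) \<omega>) \<partial>M)"
    by (intro nn_integral_cong) (auto simp: below_def indicator_def atLeastAtMostSuc_conv)
  also have "\<dots> = (\<integral>\<^sup>+\<omega>. indicator (below t (Suc n)) \<omega>
      * (\<integral>\<^sup>+u. indicator {..t} u \<partial>step_kernel (S (Suc n) \<omega>)) \<partial>M)"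
    by (intro markov_nn_integral below_past) auto
  also have "\<dots> = (\<integral>\<^sup>+\<omega>. ennreal (G t) * indicator (below t (Suc n)) \<omega>
      + ennreal (h t) * (indicator (below t (Suc n)) \<omega> * ennreal (williamson \<alpha> t (S (Suc n) \<omega>))) \<partial>M)"
  proof (intro nn_integral_cong)
    fix \<omega> assume "\<omega> \<in> space M"
    \<comment> \<open>On \<open>below t (Suc n)\<close> the last position is at most t, so the
      indicator of \<open>{..t}\<close> produced by the one-step formula is 1 there.\<close>
    then show "indicator (below t (Suc n)) \<omega> * (\<integral>\<^sup>+u. indicator {..t} u \<partial>step_kernel (S (Suc n) \<omega>))
      = ennreal (G t) * indicator (below t (Suc n)) \<omega>
      + ennreal (h t) * (indicator (below t (Suc n)) \<omega> * ennreal (williamson \<alpha> t (S (Suc n) \<omega>)))"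
      using t by (subst nn_integral_step_kernel_atMost) (auto simp: S_nonneg indicator_def below_def)
  qed
  also have "\<dots> = ennreal (G t) * emeasure M (below t (Suc n)) + ennreal (h t) * ennreal (G t ^ Suc n)"
    by (subst nn_integral_add)
      (auto simp: nn_integral_cmult nn_integral_below_williamson[OF t] simp del: power_Suc)
  also have "\<dots> = ennreal (G t * (G t ^ Suc n + real (Suc n) * h t * G t ^ n) + h t * G t ^ Suc n)"
    unfolding Suc using transform_nonneg[OF t] scaled_moment_nonneg[OF t] by (simp add: ennreal_mult)
  finally show ?case by (simp add: algebra_simps)
qed

text \<open>As \<open>enat\<close> is countable, preimages of points suffice, and each is a
  countable Boolean combination of the survival events {N(t) > n}.\<close>

lemma renewal_process_measurable: "renewal_process S t \<in> M \<rightarrow>\<^sub>M count_space UNIV"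
proof (subst measurable_count_space_eq_countable, simp, intro conjI ballI)
  have gt: "{\<omega> \<in> space M. enat n < renewal_process S t \<omega>} = below t (Suc n)" for n
    by (auto simp: renewal_process_gt_iff below_def)
  have [measurable]: "Measurable.pred M (\<lambda>\<omega>. enat n < renewal_process S t \<omega>)" for n
    by (simp add: pred_def gt)
  fix a :: enat
  have "{\<omega> \<in> space M. renewal_process S t \<omega> = a} \<in> sets M"
  proof (cases a)
    case (enat n)
    have "(renewal_process S t \<omega> = a)
        \<longleftrightarrow> (\<not> enat n < renewal_process S t \<omega> \<and> (\<forall>m<n. enat m < renewal_process S t \<omega>))" for \<omega>
      unfolding enat by (cases "renewal_process S t \<omega>") (auto intro: linorder_cases)
    then show ?thesis by simp
  next
    case infinity
    have "(renewal_process S t \<omega> = a) \<longleftrightarrow> (\<forall>m. enat m < renewal_process S t \<omega>)" for \<omega>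
      unfolding infinity by (cases "renewal_process S t \<omega>") auto
    then show ?thesis by simp
  qed
  then show "renewal_process S t -` {a} \<inter> space M \<in> sets M"
    by (simp add: vimage_def Int_def conj_commute)
qed simp

text \<open>The event {N(t) > n} is \<open>below t (Suc n)\<close>, so the tail sum of the
  expectation runs over exactly the probabilities computed in \<open>emeasure_below\<close>. The
  terms (n+1) G^n form the differentiated geometric series, with sum 1/(1-G)^2.\<close>

lemma renewal_function_eq:
  assumes t: "0 < t" and "G t < 1"
  shows "renewal_function M S t = ennreal (G t / (1 - G t) + h t / (1 - G t)\<^sup>2)"
proof -
  note nn = transform_nonneg[OF t] scaled_moment_nonneg[OF t]
  have "(\<lambda>n. G t * G t ^ n + h t * (of_nat (Suc n) * G t ^ n)) sums (G t * (1 / (1 - G t)) + h t * (1 / (1 - G t)\<^sup>2))"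
    using assms nn by (intro sums_add sums_mult geometric_sums geometric_deriv_sums) auto
  then have sums: "(\<lambda>n. G t ^ Suc n + real (Suc n) * h t * G t ^ n) sums (G t / (1 - G t) + h t / (1 - G t)\<^sup>2)"
    by (simp add: mult_ac)
  have "renewal_function M S t = (\<Sum>n. emeasure M {\<omega> \<in> space M. enat n < renewal_process S t \<omega>})"
    unfolding renewal_function_def by (rule nn_integral_enat_function[OF renewal_process_measurable])
  also have "\<dots> = (\<Sum>n. ennreal (G t ^ Suc n + real (Suc n) * h t * G t ^ n))"
    using emeasure_below[OF t] by (simp add: renewal_process_gt_iff below_def)
  also have "\<dots> = ennreal (G t / (1 - G t) + h t / (1 - G t)\<^sup>2)"
    using nn by (intro suminf_ennreal_eq sums) auto
  finally show ?thesis .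
qed

end

theorem corollary1:
  fixes \<alpha> \<theta> :: real and \<nu> :: "real measure"
    and M :: "'w measure" and S :: "nat \<Rightarrow> 'w \<Rightarrow> real"
  assumes "\<alpha> > 0"
    and "\<nu> \<in> nonneg_prob"
    and "kendall_random_walk \<alpha> \<nu> M S"
    and "regularly_varying \<theta> (truncated_moment \<alpha> \<nu>)"
    and "0 \<le> \<theta>" and "\<theta> < \<alpha>"
  shows "((\<lambda>x. ennreal (x powr (- \<alpha>)) * renewal_function M S x * ennreal (truncated_moment \<alpha> \<nu> x))
           \<longlongrightarrow> ennreal ((\<alpha> - \<theta>) * (2 * \<alpha> - \<theta>) / \<alpha>\<^sup>2)) at_top"
proof -
  interpret kendall_walk \<alpha> \<nu> M S
    using assms by unfold_locales
  define H where "H = truncated_moment \<alpha> \<nu>"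
  have H_pos: "\<forall>\<^sub>F t in at_top. 0 < H t"
    and H_lim: "\<And>x. 0 < x \<Longrightarrow> ((\<lambda>t. H (t * x) / H t) \<longlongrightarrow> x powr \<theta>) at_top"
    using assms by (auto simp: regularly_varying_def H_def)
  have h_eq: "h t = t powr (-\<alpha>) * H t" if "0 < t" for t
    using scaled_moment_eq[OF that] by (simp add: H_def)
  have h_pos: "\<forall>\<^sub>F t in at_top. 0 < h t"
    using H_pos eventually_gt_at_top[of 0] by eventually_elim (simp add: h_eq)
  have "((\<lambda>t. (1 - G t) / h t) \<longlongrightarrow> \<alpha> / (\<alpha> - \<theta>)) at_top"
  proof (rule karamata_ratio_limit[OF assms(5,6) h_pos])
    fix r :: real assume r: "1 < r"
    \<comment> \<open>The factor t^(-\<alpha>) in h lowers the index of regular variation from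
      \<theta> to \<theta> - \<alpha>, which is negative.\<close>
    have "((\<lambda>t. r powr (-\<alpha>) * (H (t * r) / H t)) \<longlongrightarrow> r powr (-\<alpha>) * r powr \<theta>) at_top"
      using r by (intro tendsto_intros H_lim) auto
    moreover have "\<forall>\<^sub>F t in at_top. r powr (-\<alpha>) * (H (t * r) / H t) = h (r * t) / h t"
      using H_pos eventually_gt_at_top[of 0]
      by eventually_elim (use r in \<open>simp add: h_eq powr_mult mult_ac\<close>)
    ultimately show "((\<lambda>t. h (r * t) / h t) \<longlongrightarrow> r powr (\<theta> - \<alpha>)) at_top"
      by (auto simp flip: powr_add elim: Lim_transform_eventually)
  next
    show "((\<lambda>t. 1 - G t) \<longlongrightarrow> 0) at_top"
      using tendsto_diff[OF tendsto_const[of 1] transform_tendsto_1] by simp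
  qed (use transform_increment in auto)
  from tendsto_inverse[OF this] have ratio: "((\<lambda>t. h t / (1 - G t)) \<longlongrightarrow> (\<alpha> - \<theta>) / \<alpha>) at_top"
    using assms by simp
  have "((\<lambda>t. G t * (h t / (1 - G t)) + (h t / (1 - G t))\<^sup>2)
      \<longlongrightarrow> 1 * ((\<alpha> - \<theta>) / \<alpha>) + ((\<alpha> - \<theta>) / \<alpha>)\<^sup>2) at_top"
    by (intro tendsto_intros ratio transform_tendsto_1)
  also have "1 * ((\<alpha> - \<theta>) / \<alpha>) + ((\<alpha> - \<theta>) / \<alpha>)\<^sup>2 = (\<alpha> - \<theta>) * (2 * \<alpha> - \<theta>) / \<alpha>\<^sup>2"
    using assms by (simp add: divide_simps power2_eq_square) (simp add: algebra_simps)
  finally have "((\<lambda>t. ennreal (G t * (h t / (1 - G t)) + (h t / (1 - G t))\<^sup>2))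
      \<longlongrightarrow> ennreal ((\<alpha> - \<theta>) * (2 * \<alpha> - \<theta>) / \<alpha>\<^sup>2)) at_top"
    by (rule tendsto_ennrealI)
  moreover have "\<forall>\<^sub>F t in at_top. ennreal (G t * (h t / (1 - G t)) + (h t / (1 - G t))\<^sup>2)
      = ennreal (t powr (- \<alpha>)) * renewal_function M S t * ennreal (truncated_moment \<alpha> \<nu> t)"
    using h_pos H_pos eventually_gt_at_top[of 0]
  proof eventually_elim
    case (elim t)
    \<comment> \<open>Eventual positivity of h gives G t < 1, so for all large t the renewal
      function is finite and has its closed form.\<close>
    have G: "0 \<le> G t" "G t < 1" using elim scaled_moment_le[of t] transform_nonneg[of t] by auto
    have "ennreal (t powr (- \<alpha>)) * renewal_function M S t * ennreal (H t)
        = ennreal (t powr (- \<alpha>) * (G t / (1 - G t) + h t / (1 - G t)\<^sup>2) * H t)"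
      using elim G by (simp add: renewal_function_eq ennreal_mult)
    also have "t powr (- \<alpha>) * (G t / (1 - G t) + h t / (1 - G t)\<^sup>2) * H t
        = h t * (G t / (1 - G t) + h t / (1 - G t)\<^sup>2)"
      using elim by (simp only: h_eq mult_ac)
    also have "\<dots> = G t * (h t / (1 - G t)) + (h t / (1 - G t))\<^sup>2"
      by (simp add: algebra_simps power2_eq_square)
    finally show ?case by (simp add: H_def)
  qed
  ultimately show ?thesis by (rule Lim_transform_eventually)
qed

end
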